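(* Let $H\in\mathbb{R}^{n\times n}$ be symmetric with eigenvalues $\alpha_1\le\alpha_2\le\dots\le\alpha_n$, let $c\in\mathbb{R}^n$, $\sigma>0$, $p>2$, and let $g(x)=\frac12x^THx+c^Tx+\frac{\sigma}{p}\|x\|^p$ for $x\in\mathbb{R}^n$. A point $\underline{x}\in\mathbb{R}^n$ is a local-nonglobal minimizer of $g$ if and only if $$\underline{x}=-(H+\sigma\underline{t}^*I)^{-1}c,$$ where $\underline{t}^*$ is a root of the secular function $$h(t)=\|(H+\sigma tI)^{-1}c\|^2-t^{\frac{2}{p-2}},\qquad t\in\left(\max\left\{-\frac{\alpha_2}{\sigma},0\right\},\,-\frac{\alpha_1}{\sigma}\right),$$ such that $h'(\underline{t}^* )>0$.
   Context: $\|\cdot\|$ is the Euclidean norm and $I$ the identity matrix of order $n$. A local-nonglobal minimizer of $g$ is a local minimizer of $g$ over $\mathbb{R}^n$ that is not a global minimizer. The open interval is understood to be empty (so no such $\underline{t}^*$ exists) if its left endpoint is not smaller than its right endpoint. For $n=1$ one uses the convention $\alpha_2=+\infty$. *)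

theory Defs
  imports "HOL-Analysis.Analysis"
begin

definition regularized_quadratic ::
    "real^'n^'n \<Rightarrow> real^'n \<Rightarrow> real \<Rightarrow> real \<Rightarrow> real^'n \<Rightarrow> real" where
  "regularized_quadratic H c \<sigma> p x =
     1 / 2 * (x \<bullet> (H *v x)) + c \<bullet> x + \<sigma> / p * norm x powr p"

definition local_minimizer :: "(real^'n \<Rightarrow> real) \<Rightarrow> real^'n \<Rightarrow> bool" where
  "local_minimizer f x \<longleftrightarrow> (\<exists>e>0. \<forall>y\<in>ball x e. f x \<le> f y)"

definition global_minimizer :: "(real^'n \<Rightarrow> real) \<Rightarrow> real^'n \<Rightarrow> bool" where
  "global_minimizer f x \<longleftrightarrow> (\<forall>y. f x \<le> f y)"

definition local_nonglobal_minimizer :: "(real^'n \<Rightarrow> real) \<Rightarrow> real^'n \<Rightarrow> bool" where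
  "local_nonglobal_minimizer f x \<longleftrightarrow> local_minimizer f x \<and> \<not> global_minimizer f x"

(* \<alpha> 1 \<le> ... \<le> \<alpha> n are the eigenvalues with multiplicity, i.e. the roots of the
   characteristic polynomial; values of \<alpha> outside {1..n} are irrelevant. *)
definition ordered_eigenvalues :: "real^'n^'n \<Rightarrow> (nat \<Rightarrow> real) \<Rightarrow> bool" where
  "ordered_eigenvalues H \<alpha> \<longleftrightarrow>
     mono_on {1..CARD('n)} \<alpha> \<and>
     (\<forall>t. det (t *\<^sub>R mat 1 - H) = (\<Prod>i=1..CARD('n). t - \<alpha> i))"

(* The second eigenvalue, with the convention that it is infinite for n = 1. *)
definition second_eigenvalue :: "nat \<Rightarrow> (nat \<Rightarrow> real) \<Rightarrow> ereal" where
  "second_eigenvalue n \<alpha> = (if n = 1 then \<infinity> else ereal (\<alpha> 2))"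

definition secular_domain :: "nat \<Rightarrow> (nat \<Rightarrow> real) \<Rightarrow> real \<Rightarrow> real set" where
  "secular_domain n \<alpha> \<sigma> =
     {t. max (- second_eigenvalue n \<alpha> / ereal \<sigma>) 0 < ereal t \<and> t < - \<alpha> 1 / \<sigma>}"

definition shifted_inverse :: "real^'n^'n \<Rightarrow> real \<Rightarrow> real \<Rightarrow> real^'n^'n" where
  "shifted_inverse H \<sigma> t = matrix_inv (H + (\<sigma> * t) *\<^sub>R mat 1)"

(* Only used on secular_domain, where H + \<sigma> t I is invertible, t > 0, and
   this function is differentiable. *)
definition secular_function ::
    "real^'n^'n \<Rightarrow> real^'n \<Rightarrow> real \<Rightarrow> real \<Rightarrow> real \<Rightarrow> real" where
  "secular_function H c \<sigma> p t =
     (norm (shifted_inverse H \<sigma> t *v c))\<^sup>2 - t powr (2 / (p - 2))"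

end

theory Submission
  imports Defs "HOL-Combinatorics.List_Permutation" "HOL-Computational_Algebra.Polynomial"
begin

text \<open>At a stationary point \<open>x\<close> put \<open>t = norm x powr (p - 2)\<close> and \<open>A = H + \<sigma> t I\<close>, so that \<open>A x = - c\<close>.
  On the sphere through \<open>x\<close> the objective grows exactly like \<open>d \<bullet> A d / 2\<close>, and off the sphere it
  exceeds this; hence \<open>x\<close> is a global minimizer iff \<open>A\<close> is positive semidefinite. Comparing a local
  minimizer with its mirror images on the sphere shows that \<open>A\<close> is positive on the hyperplane
  orthogonal to \<open>x\<close> up to degenerate directions, which forces exactly one negative eigenvalue, that is,
  \<open>t\<close> lies in the open secular interval. The Hessian at \<open>x\<close> is \<open>A + \<beta> x x\<^sup>T\<close>, and \<open>h' t > 0\<close> says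
  \<open>1 + \<beta> (x \<bullet> A\<^sup>-\<^sup>1 x) < 0\<close>, which together with the one negative eigenvalue makes the Hessian positive
  definite. Conversely, the objective is differentiated along the curve \<open>s \<mapsto> - (H + \<sigma> s I)\<^sup>-\<^sup>1 c\<close>; a root
  of \<open>h\<close> with \<open>h' \<le> 0\<close> would give descent, the case \<open>h' = 0\<close> being settled by the Cauchy-Schwarz
  bound \<open>\<psi> \<psi>'' \<ge> 3/2 \<psi>'\<^sup>2\<close> for \<open>\<psi> s = norm ((H + \<sigma> s I)\<^sup>-\<^sup>1 c)\<^sup>2\<close>, which makes \<open>h\<close> strictly convex at a double root.\<close>

subsection \<open>Spectral theorem\<close>

text \<open>For small \<open>e\<close> the linear term dominates, so a step against the sign of
  \<open>a\<close> would make the polynomial negative. This is the first-order condition for the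
  Rayleigh quotient.\<close>

lemma quadratic_nonneg_imp_linear_zero:
  fixes a b :: real
  assumes "\<And>e. 0 \<le> 2 * e * a + e\<^sup>2 * b"
  shows "a = 0"
proof (rule ccontr)
  assume "a \<noteq> 0"
  \<comment> \<open>With this step the bound \<open>e\<^sup>2 * (\<bar>b\<bar> + 1)\<close> equals
    \<open>- e * a\<close>, half the size of the linear term \<open>2 * e * a\<close>, which leaves
    the negative value \<open>e * a\<close>.\<close>
  define e where "e = - a / (\<bar>b\<bar> + 1)"
  have "e * (\<bar>b\<bar> + 1) = - a" by (simp add: e_def)
  have "2 * e * a + e\<^sup>2 * b \<le> 2 * e * a + e\<^sup>2 * (\<bar>b\<bar> + 1)"
    by (intro add_left_mono mult_left_mono) auto
  also have "\<dots> = 2 * e * a + e * (e * (\<bar>b\<bar> + 1))"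
    by (simp add: power2_eq_square)
  also have "\<dots> = e * a"
    unfolding \<open>e * (\<bar>b\<bar> + 1) = - a\<close> by simp
  also have "\<dots> = - (a\<^sup>2 / (\<bar>b\<bar> + 1))"
    by (simp add: e_def power2_eq_square)
  also have "\<dots> < 0"
    using \<open>a \<noteq> 0\<close> by (simp add: divide_pos_pos)
  finally show False using assms[of e] by simp
qed

text \<open>A minimizer of the Rayleigh quotient on the compact unit sphere of \<open>S\<close> is
  an eigenvector, and the minimum is its eigenvalue.\<close>

lemma self_adjoint_eigenvector:
  fixes f :: "'a::euclidean_space \<Rightarrow> 'a"
  assumes "linear f" and adj: "\<And>x y. f x \<bullet> y = x \<bullet> f y"
    and S: "subspace S" "f ` S \<subseteq> S" "S \<noteq> {0}"
  obtains v \<mu> where "v \<in> S" "norm v = 1" "f v = \<mu> *\<^sub>R v"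
proof -
  interpret linear f by fact
  define K where "K = S \<inter> sphere 0 1"
  have "compact K"
    unfolding K_def by (intro closed_Int_compact closed_subspace S compact_sphere)
  moreover have "K \<noteq> {}"
  proof -
    obtain x where "x \<in> S" "x \<noteq> 0"
      using S subspace_0 by blast
    then have "x /\<^sub>R norm x \<in> K"
      using S by (auto simp: K_def subspace_scale)
    then show ?thesis by blast
  qed
  moreover have "continuous_on K (\<lambda>x. x \<bullet> f x)"
    using linear_continuous_on[OF linear_conv_bounded_linear[THEN iffD1, OF \<open>linear f\<close>]]
    by (intro continuous_on_inner continuous_on_id)
  ultimately obtain v where v: "v \<in> K" and min: "\<forall>y\<in>K. v \<bullet> f v \<le> y \<bullet> f y"
    using continuous_attains_inf[of K "\<lambda>x. x \<bullet> f x"] by auto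
  define \<mu> where "\<mu> = v \<bullet> f v"
  have vS: "v \<in> S" and v1: "norm v = 1" "v \<bullet> v = 1"
    using v by (auto simp: K_def norm_eq_1)
  have rayleigh: "\<mu> * (y \<bullet> y) \<le> y \<bullet> f y" if "y \<in> S" for y
  proof (cases "y = 0")
    case False
    have "y /\<^sub>R norm y \<in> K"
      using that False S by (auto simp: K_def subspace_scale)
    from min[rule_format, OF this] have "\<mu> \<le> (y \<bullet> f y) / (norm y)\<^sup>2"
      by (simp add: \<mu>_def scaleR power2_eq_square divide_simps)
    then show ?thesis using False
      by (simp add: field_simps power2_norm_eq_inner)
  qed (simp add: zero)
  \<comment> \<open>The residual serves as its own direction of variation: the first-order term at
    the minimizer is \<open>u \<bullet> u\<close>, so it must vanish. Invariance of \<open>S\<close>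
    keeps this direction inside \<open>S\<close>.\<close>
  define u where "u = f v - \<mu> *\<^sub>R v"
  have uS: "u \<in> S"
  proof -
    have "f v \<in> S" using vS S(2) by auto
    then show ?thesis
      unfolding u_def by (intro subspace_diff[OF S(1)] subspace_scale[OF S(1)] vS)
  qed
  have "u \<bullet> u = 0"
  proof (rule quadratic_nonneg_imp_linear_zero)
    fix e :: real
    have "0 \<le> (v + e *\<^sub>R u) \<bullet> f (v + e *\<^sub>R u) - \<mu> * ((v + e *\<^sub>R u) \<bullet> (v + e *\<^sub>R u))"
      using rayleigh[of "v + e *\<^sub>R u"] vS uS S by (simp add: subspace_add subspace_scale)
    also have "\<dots> = 2 * e * (u \<bullet> (f v - \<mu> *\<^sub>R v)) + e\<^sup>2 * (u \<bullet> f u - \<mu> * (u \<bullet> u))"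
    proof -
      have "v \<bullet> f u = u \<bullet> f v" using adj[of v u] by (simp add: inner_commute)
      then show ?thesis using v1(2)
        by (simp add: add scaleR inner_add_left inner_add_right inner_diff_right \<mu>_def[symmetric] inner_commute[of v u])
          (simp add: algebra_simps power2_eq_square)
    qed
    finally show "0 \<le> 2 * e * (u \<bullet> u) + e\<^sup>2 * (u \<bullet> f u - \<mu> * (u \<bullet> u))"
      by (simp add: u_def)
  qed
  then have "f v = \<mu> *\<^sub>R v" by (simp add: u_def)
  then show thesis using that vS v1 by blast
qed

text \<open>Induction on the dimension: one eigenvector is split off, and by self-adjointness its
  orthogonal complement within \<open>S\<close> is again invariant.\<close>

lemma self_adjoint_eigenbasis_subspace:
  fixes f :: "'a::euclidean_space \<Rightarrow> 'a"
  assumes "linear f" and adj: "\<And>x y. f x \<bullet> y = x \<bullet> f y"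
    and "subspace S" "f ` S \<subseteq> S"
  shows "\<exists>B. finite B \<and> B \<subseteq> S \<and> card B = dim S \<and> pairwise orthogonal B \<and>
    (\<forall>b\<in>B. norm b = 1 \<and> (\<exists>\<mu>. f b = \<mu> *\<^sub>R b))"
  using assms(3,4)
proof (induction "dim S" arbitrary: S)
  case 0
  then have "S \<subseteq> {0}" by simp
  then show ?case using 0
    by (intro exI[of _ "{}"]) auto
next
  case (Suc k)
  interpret linear f by fact
  have "S \<noteq> {0}" using Suc.hyps(2) by auto
  then obtain v \<mu> where v: "v \<in> S" "norm v = 1" "f v = \<mu> *\<^sub>R v"
    using self_adjoint_eigenvector[OF assms(1) adj Suc.prems] by metis
  define T where "T = {y \<in> S. \<forall>x \<in> span {v}. orthogonal x y}"
  have T_iff: "y \<in> T \<longleftrightarrow> y \<in> S \<and> v \<bullet> y = 0" for y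
    by (auto simp: T_def orthogonal_def span_singleton)
  have "span {v} \<subseteq> S"
    using v Suc.prems by (simp add: span_minimal)
  then have "dim T + dim (span {v}) = dim S"
    unfolding T_def by (intro dim_subspace_orthogonal_to_vectors Suc.prems subspace_span)
  moreover have "dim (span {v}) = 1"
    using v by (auto simp: dim_singleton dim_span)
  ultimately have "k = dim T" using Suc.hyps(2) by simp
  moreover have "subspace T"
    using Suc.prems unfolding subspace_def by (auto simp: T_iff inner_simps)
  moreover have "f ` T \<subseteq> T"
    using Suc.prems adj[of v] by (auto simp: T_iff v(3) image_subset_iff simp flip: adj)
  ultimately obtain B where B: "finite B" "B \<subseteq> T" "card B = dim T" "pairwise orthogonal B"
    "\<forall>b\<in>B. norm b = 1 \<and> (\<exists>\<mu>. f b = \<mu> *\<^sub>R b)"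
    using Suc.hyps(1)[of T] by blast
  have "v \<notin> T" using v by (auto simp: T_iff)
  then have "v \<notin> B" using B by blast
  show ?case
  proof (intro exI[of _ "insert v B"] conjI)
    show "insert v B \<subseteq> S" using v B by (auto simp: T_iff)
    show "card (insert v B) = dim S"
      using \<open>v \<notin> B\<close> B \<open>k = dim T\<close> Suc.hyps(2) by simp
    show "pairwise orthogonal (insert v B)"
      using B by (auto simp: pairwise_insert orthogonal_def T_iff inner_commute)
  qed (use v B in auto)
qed

section \<open>Eigenvalues with multiplicity and an eigenbasis in their order\<close>

lemma inner_symmetric_matrix:
  fixes H :: "real^'n^'n"
  assumes "transpose H = H"
  shows "(H *v x) \<bullet> y = x \<bullet> (H *v y)"
  by (metis assms dot_lmul_matrix vector_transpose_matrix)

text \<open>Both products are the same polynomial, and a polynomial determines its multiset of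
  roots. This transfers multiplicities from the characteristic polynomial to the eigenbasis.\<close>

lemma prod_linear_eq_imp_image_mset_eq:
  fixes a :: "'i \<Rightarrow> real" and b :: "'j \<Rightarrow> real"
  assumes "finite I" "finite J"
    and "\<And>t. (\<Prod>i\<in>I. t - a i) = (\<Prod>j\<in>J. t - b j)"
  shows "image_mset a (mset_set I) = image_mset b (mset_set J)"
proof -
  have *: "proots (\<Prod>i\<in>K. [:- f i, 1:]) = image_mset f (mset_set K)" if "finite K"
    for f :: "'k \<Rightarrow> real" and K
    using that by (subst proots_prod) (auto simp: sum_unfold_sum_mset simp flip: image_mset.compositionality)
  have "(\<Prod>i\<in>I. [:- a i, 1:]) = (\<Prod>j\<in>J. [:- b j, 1:])"
    using assms(3) by (intro poly_eqI_degree poly_ext) (simp add: poly_prod)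
  then show ?thesis using *[of I a] *[of J b] assms by simp
qed

text \<open>The spectral theorem gives an unordered eigenbasis \<open>B\<close>. Diagonalizing with
  it yields the characteristic polynomial in terms of \<open>B\<close>; equality of the root
  multisets then provides a permutation that matches \<open>B\<close> with \<open>\<alpha>\<close>,
  multiplicities included.\<close>

lemma ordered_eigenvalues_eigenbasis:
  fixes H :: "real^'n^'n"
  assumes sym: "transpose H = H" and ev: "ordered_eigenvalues H \<alpha>"
  obtains v where
    "\<And>i j. i \<in> {1..CARD('n)} \<Longrightarrow> j \<in> {1..CARD('n)} \<Longrightarrow> v i \<bullet> v j = (if i = j then 1 else 0)"
    "\<And>i. i \<in> {1..CARD('n)} \<Longrightarrow> H *v v i = \<alpha> i *\<^sub>R v i"
    "\<And>y. y = (\<Sum>i=1..CARD('n). (y \<bullet> v i) *\<^sub>R v i)"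
proof -
  define n where "n = CARD('n)"
  have "linear ((*v) H)" by simp
  then obtain B :: "(real^'n) set" where B: "finite B" "card B = n" "pairwise orthogonal B"
    and Bev: "\<forall>b\<in>B. norm b = 1 \<and> (\<exists>\<mu>. H *v b = \<mu> *\<^sub>R b)"
    using self_adjoint_eigenbasis_subspace[of "(*v) H" UNIV] inner_symmetric_matrix[OF sym]
    by (auto simp: n_def)
  define \<mu> where "\<mu> b = (SOME m. H *v b = m *\<^sub>R b)" for b
  have \<mu>: "H *v b = \<mu> b *\<^sub>R b" if "b \<in> B" for b
    unfolding \<mu>_def by (rule someI_ex) (use Bev that in blast)
  have ortho: "a \<bullet> b = (if a = b then 1 else 0)" if "a \<in> B" "b \<in> B" for a b
    using that Bev B(3) by (auto simp: pairwise_def orthogonal_def norm_eq_1)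
  have "0 \<notin> B" using Bev by auto
  then have "independent B"
    using B(3) pairwise_orthogonal_independent by blast
  then have "span B = UNIV"
    using B(1,2) card_ge_dim_independent[of B UNIV] by (simp add: n_def top.extremum_uniqueI)
  have expand: "y = (\<Sum>b\<in>B. (y \<bullet> b) *\<^sub>R b)" for y
  proof -
    have "y \<in> span B" using \<open>span B = UNIV\<close> by simp
    then obtain u where u: "y = (\<Sum>b\<in>B. u b *\<^sub>R b)"
      using B(1) by (auto simp: span_finite)
    have "y \<bullet> b = u b" if "b \<in> B" for b
    proof -
      have "y \<bullet> b = (\<Sum>a\<in>B. if a = b then u b else 0)"
        unfolding u inner_sum_left using that by (intro sum.cong) (auto simp: ortho)
      then show ?thesis using that B(1) by simp
    qed
    then have "(\<Sum>b\<in>B. (y \<bullet> b) *\<^sub>R b) = (\<Sum>b\<in>B. u b *\<^sub>R b)"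
      by (intro sum.cong) auto
    then show ?thesis using u by simp
  qed
  obtain f :: "'n \<Rightarrow> real^'n" where f: "bij_betw f UNIV B"
    using B by (metis finite_class.finite_UNIV finite_same_card_bij n_def)
  have fB: "f j \<in> B" for j using f by (auto simp: bij_betw_def)
  have f_eq: "f i = f j \<longleftrightarrow> i = j" for i j
    using f by (auto simp: bij_betw_def inj_on_def)
  \<comment> \<open>The columns of \<open>P\<close> are the vectors of \<open>B\<close>, so
    \<open>P\<close> is orthogonal and conjugates \<open>H\<close> to diagonal form.\<close>
  define P :: "real^'n^'n" where "P = (\<chi> i j. f j $ i)"
  have "orthogonal_matrix P"
    unfolding orthogonal_matrix_orthonormal_columns
    using fB by (auto simp: P_def column_def vec_lambda_eta norm_eq_1 orthogonal_def ortho f_eq)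
  then have "det P \<noteq> 0"
    using det_orthogonal_matrix by force
  have "det (t *\<^sub>R mat 1 - H) = (\<Prod>b\<in>B. t - \<mu> b)" for t
  proof -
    define D :: "real^'n^'n" where "D = (\<chi> i j. if i = j then t - \<mu> (f j) else 0)"
    have "column j ((t *\<^sub>R mat 1 - H) ** P) = column j (P ** D)" for j
    proof -
      have "column j ((t *\<^sub>R mat 1 - H) ** P) = (t *\<^sub>R mat 1 - H) *v f j"
        by (simp add: vec_eq_iff column_def matrix_matrix_mult_def matrix_vector_mult_def P_def)
      also have "\<dots> = (t - \<mu> (f j)) *\<^sub>R f j"
        using \<mu>[OF fB, of j]
        by (simp add: matrix_vector_mult_diff_rdistrib scaleR_matrix_vector_assoc[symmetric] scaleR_diff_left)
      also have "\<dots> = column j (P ** D)"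
        by (simp add: vec_eq_iff column_def matrix_matrix_mult_def P_def D_def if_distrib
            sum.delta mult.commute cong: if_cong)
      finally show ?thesis .
    qed
    then have "(t *\<^sub>R mat 1 - H) ** P = P ** D"
      by (simp add: vec_eq_iff column_def)
    then have "det (t *\<^sub>R mat 1 - H) * det P = det P * det D"
      by (metis det_mul)
    then have "det (t *\<^sub>R mat 1 - H) = det D" using \<open>det P \<noteq> 0\<close> by simp
    also have "\<dots> = (\<Prod>j\<in>UNIV. t - \<mu> (f j))"
      by (subst det_diagonal) (auto simp: D_def)
    also have "\<dots> = (\<Prod>b\<in>B. t - \<mu> b)"
      by (rule prod.reindex_bij_betw[OF f])
    finally show ?thesis .
  qed
  with ev have "(\<Prod>b\<in>B. t - \<mu> b) = (\<Prod>i=1..n. t - \<alpha> i)" for t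
    by (simp add: ordered_eigenvalues_def n_def)
  then have ms: "image_mset \<mu> (mset_set B) = image_mset \<alpha> (mset_set {1..n})"
    by (intro prod_linear_eq_imp_image_mset_eq B) auto
  obtain bs where bs: "set bs = B" "distinct bs"
    using B finite_distinct_list by blast
  then have len: "length bs = n" using B distinct_card by force
  have "mset (map \<alpha> [1..<Suc n]) = mset (map \<mu> bs)"
    using ms unfolding bs(1)[symmetric] mset_map mset_set_set[OF bs(2)] mset_upt atLeastLessThanSuc_atLeastAtMost
    by simp
  then obtain g where g: "bij_betw g {..<n} {..<n}"
    and g_eq: "\<And>i. i < n \<Longrightarrow> map \<alpha> [1..<Suc n] ! i = map \<mu> bs ! g i"
    using permutation_Ex_bij[of "map \<alpha> [1..<Suc n]" "map \<mu> bs"] len by (auto simp del: upt_Suc)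
  \<comment> \<open>The eigenvalues are numbered from 1 and list positions from 0, hence the shift
    before the permutation \<open>g\<close> is applied.\<close>
  define v where "v i = bs ! g (i - 1)" for i
  have "bij_betw (\<lambda>i. i - 1) {1..n} {..<n}"
    by (rule bij_betw_byWitness[where f' = Suc]) auto
  moreover have "bij_betw ((!) bs) {..<n} B"
    using bs len bij_betw_nth by blast
  ultimately have "bij_betw ((!) bs \<circ> g \<circ> (\<lambda>i. i - 1)) {1..n} B"
    using g bij_betw_trans by blast
  then have v: "bij_betw v {1..n} B"
    by (simp add: v_def o_def cong: bij_betw_cong)
  then have vB: "v i \<in> B" if "i \<in> {1..n}" for i
    using that by (auto simp: bij_betw_def)
  show thesis
  proof
    fix i j assume "i \<in> {1..CARD('n)}" "j \<in> {1..CARD('n)}"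
    then show "v i \<bullet> v j = (if i = j then 1 else 0)"
      using ortho[of "v i" "v j"] vB v unfolding n_def bij_betw_def inj_on_def by metis
  next
    fix i assume "i \<in> {1..CARD('n)}"
    then have i: "i \<in> {1..n}" by (simp add: n_def)
    then have "i - 1 < n" "g (i - 1) < n"
      using g by (auto simp: bij_betw_def)
    then have "\<alpha> i = \<mu> (v i)"
      using g_eq[of "i - 1"] i len by (simp add: v_def del: upt_Suc)
    then show "H *v v i = \<alpha> i *\<^sub>R v i" using \<mu> vB i by simp
  next
    fix y
    show "y = (\<Sum>i=1..CARD('n). (y \<bullet> v i) *\<^sub>R v i)"
      using expand[of y] sum.reindex_bij_betw[OF v, of "\<lambda>b. (y \<bullet> b) *\<^sub>R b"]
      by (simp add: n_def)
  qed
qed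

subsection \<open>Stationary points and the shifted quadratic form\<close>

text \<open>The sign near 0 is that of the first nonvanishing coefficient. The limit gives
  \<open>a\<close>, division by \<open>e\<close> from both sides gives \<open>b\<close>, and then
  only \<open>e\<^sup>2 * k\<close> is left. The neighbourhood is punctured because the reflections
  to which this is applied degenerate at \<open>e = 0\<close>.\<close>

lemma eventually_quadratic_nonneg:
  fixes a b k :: real
  assumes ev: "\<forall>\<^sub>F e in at 0. 0 \<le> a + 2 * e * b + e\<^sup>2 * k"
  shows "0 \<le> a" and "a = 0 \<Longrightarrow> b = 0" and "a = 0 \<Longrightarrow> b = 0 \<Longrightarrow> 0 \<le> k"
proof -
  have "((\<lambda>e. a + 2 * e * b + e\<^sup>2 * k) \<longlongrightarrow> a + 2 * 0 * b + 0\<^sup>2 * k) (at 0)"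
    by (intro tendsto_intros)
  from tendsto_lowerbound[OF this ev] show "0 \<le> a" by simp
  show "b = 0" if "a = 0"
  proof (rule antisym)
    have lim: "((\<lambda>e. 2 * b + e * k) \<longlongrightarrow> 2 * b + 0 * k) (at 0)"
      by (intro tendsto_intros)
    have R: "\<forall>\<^sub>F e in at_right 0. 0 \<le> a + 2 * e * b + e\<^sup>2 * k"
      and L: "\<forall>\<^sub>F e in at_left 0. 0 \<le> a + 2 * e * b + e\<^sup>2 * k"
      using ev by (auto simp: eventually_at_split)
    have "\<forall>\<^sub>F e in at_right 0. 0 \<le> 2 * b + e * k"
      using R eventually_at_right_less
    proof eventually_elim
      case (elim e)
      then have "0 \<le> e * (2 * b + e * k)"
        using that by (simp add: algebra_simps power2_eq_square)
      then show ?case using elim by (simp add: zero_le_mult_iff)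
    qed
    from tendsto_lowerbound[OF filterlim_mono[OF lim order.refl at_le] this]
    show "0 \<le> b" by simp
    have eventually_at_left_less: "\<forall>\<^sub>F e::real in at_left 0. e < 0"
      by (simp add: eventually_at_filter)
    have "\<forall>\<^sub>F e in at_left 0. 2 * b + e * k \<le> 0"
      using L eventually_at_left_less
    proof eventually_elim
      case (elim e)
      then have "0 \<le> e * (2 * b + e * k)"
        using that by (simp add: algebra_simps power2_eq_square)
      then show ?case using elim by (simp add: zero_le_mult_iff)
    qed
    from tendsto_upperbound[OF filterlim_mono[OF lim order.refl at_le] this]
    show "b \<le> 0" by simp
  qed
  show "0 \<le> k" if "a = 0" "b = 0"
  proof (rule ccontr)
    assume "\<not> 0 \<le> k"
    have "\<forall>\<^sub>F e in at (0::real). e \<noteq> 0"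
      by (simp add: eventually_neq_at_within)
    with ev have "\<forall>\<^sub>F e in at (0::real). False"
      by eventually_elim (use that \<open>\<not> 0 \<le> k\<close> in \<open>auto simp: zero_le_mult_iff\<close>)
    then show False by simp
  qed
qed

text \<open>In the variable \<open>u = r\<^sup>2\<close> the convex function
  \<open>u powr (p / 2)\<close> lies above its tangent at \<open>r0\<^sup>2\<close>. The proof is
  Young's inequality with the conjugate exponents \<open>p / 2\<close> and
  \<open>p / (p - 2)\<close>.\<close>

lemma powr_ge_tangent_in_square:
  fixes r r0 p :: real
  assumes "p > 2" "r \<ge> 0" "r0 > 0"
  shows "p / 2 * r0 powr (p - 2) * (r\<^sup>2 - r0\<^sup>2) \<le> r powr p - r0 powr p"
proof (cases "r = 0")
  case True
  have "r0 powr (p - 2) * r0\<^sup>2 = r0 powr p"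
    using assms by (simp add: powr_diff)
  then show ?thesis using True assms by (simp add: algebra_simps)
next
  case False
  have "r\<^sup>2 * r0 powr (p - 2) \<le> (r\<^sup>2) powr (p / 2) / (p / 2) + (r0 powr (p - 2)) powr (p / (p - 2)) / (p / (p - 2))"
    using assms by (intro Youngs_inequality) (auto simp: field_simps)
  also have "(r\<^sup>2) powr (p / 2) = r powr p"
    using False assms by (simp flip: powr_numeral add: powr_powr)
  also have "(r0 powr (p - 2)) powr (p / (p - 2)) = r0 powr p"
    using assms by (simp add: powr_powr)
  finally have *: "p / 2 * (r\<^sup>2 * r0 powr (p - 2)) \<le> p / 2 * (r powr p / (p / 2) + r0 powr p / (p / (p - 2)))"
    using assms by (intro mult_left_mono) auto
  have "p / 2 * (r powr p / (p / 2) + r0 powr p / (p / (p - 2))) = r powr p + (p - 2) / 2 * r0 powr p"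
    using assms by (simp add: field_simps)
  moreover have "r0 powr (p - 2) * r0\<^sup>2 = r0 powr p"
    using assms by (simp add: powr_diff)
  then have "p / 2 * (r0 powr (p - 2) * r0\<^sup>2) = p / 2 * r0 powr p" by simp
  moreover have "p / 2 * r0 powr (p - 2) * (r\<^sup>2 - r0\<^sup>2)
      = p / 2 * (r\<^sup>2 * r0 powr (p - 2)) - p / 2 * (r0 powr (p - 2) * r0\<^sup>2)"
    by (simp only: right_diff_distrib mult.commute mult.left_commute mult.assoc)
  moreover have "(p - 2) / 2 * r0 powr p = p / 2 * r0 powr p - r0 powr p"
    by (simp add: field_simps)
  ultimately show ?thesis using * by linarith
qed

section \<open>Growth of the objective at stationary points, and necessary conditions by
  reflection\<close>

locale regularized_problem =
  fixes H :: "real^'n^'n" and c :: "real^'n" and \<sigma> p :: real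
  assumes sym: "transpose H = H" and \<sigma>_pos: "\<sigma> > 0" and p_gt: "p > 2"
begin

abbreviation g :: "real^'n \<Rightarrow> real" where
  "g \<equiv> regularized_quadratic H c \<sigma> p"

text \<open>The bilinear form of the matrix A from the overview.\<close>

definition bil :: "real \<Rightarrow> real^'n \<Rightarrow> real^'n \<Rightarrow> real" where
  "bil t a b = a \<bullet> (H *v b) + \<sigma> * t * (a \<bullet> b)"

lemma bil_commute: "bil t a b = bil t b a"
  using inner_symmetric_matrix[OF sym, of a b] by (simp add: bil_def inner_commute)

lemma bil_add_left: "bil t (a + b) d = bil t a d + bil t b d"
  and bil_scale_left: "bil t (r *\<^sub>R a) d = r * bil t a d"
  by (simp_all add: bil_def inner_add_left algebra_simps)

lemma bil_add_right: "bil t d (a + b) = bil t d a + bil t d b"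
  and bil_scale_right: "bil t d (r *\<^sub>R a) = r * bil t d a"
  by (simp_all add: bil_commute[of t d] bil_add_left bil_scale_left)

lemmas bil_simps = bil_add_left bil_add_right bil_scale_left bil_scale_right

lemma bil_quadratic: "bil t (a + e *\<^sub>R b) (a + e *\<^sub>R b) = bil t a a + 2 * e * bil t b a + e\<^sup>2 * bil t b b"
  by (simp add: bil_simps bil_commute[of t a b] power2_eq_square algebra_simps)

definition stationary :: "real^'n \<Rightarrow> real \<Rightarrow> bool" where
  "stationary x t \<longleftrightarrow> t = norm x powr (p - 2) \<and> H *v x + (\<sigma> * t) *\<^sub>R x = - c"

lemma stationary_bil: "stationary x t \<Longrightarrow> bil t d x = - (c \<bullet> d)"
  unfolding stationary_def bil_def by (metis inner_add_right inner_commute inner_minus_left inner_scaleR_right)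

text \<open>An exact expansion: stationarity removes the linear terms, and completing
  \<open>H\<close> to the shifted matrix is compensated by the difference of squared norms. The
  bracket depends on the norms alone and vanishes on the sphere through \<open>x\<close>.\<close>

lemma growth_identity:
  assumes "stationary x t"
  shows "g (x + d) - g x = 1 / 2 * bil t d d
    + (\<sigma> / p * (norm (x + d) powr p - norm x powr p) - \<sigma> * t / 2 * ((norm (x + d))\<^sup>2 - (norm x)\<^sup>2))"
proof -
  have "(x + d) \<bullet> (H *v (x + d)) - x \<bullet> (H *v x) = bil t d d + 2 * bil t d x
      - \<sigma> * t * ((norm (x + d))\<^sup>2 - (norm x)\<^sup>2)"
  proof -
    have "x \<bullet> (H *v d) = d \<bullet> (H *v x)"
      by (metis inner_commute inner_symmetric_matrix sym)
    then show ?thesis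
      by (simp add: bil_def power2_norm_eq_inner matrix_vector_right_distrib
        inner_add_left inner_add_right inner_commute[of x d])
        (simp add: algebra_simps)
  qed
  then show ?thesis
    using stationary_bil[OF assms, of d]
    by (simp add: regularized_quadratic_def inner_add_right right_diff_distrib)
qed

text \<open>The tangent inequality makes the bracket in \<open>growth_identity\<close> nonnegative
  everywhere.\<close>

lemma stationary_psd_imp_global_minimizer:
  assumes "stationary x t" "x \<noteq> 0" "\<And>d. bil t d d \<ge> 0"
  shows "global_minimizer g x"
  unfolding global_minimizer_def
proof
  fix y :: "real^'n"
  have "p / 2 * t * ((norm y)\<^sup>2 - (norm x)\<^sup>2) \<le> norm y powr p - norm x powr p"
    using powr_ge_tangent_in_square[of p "norm y" "norm x"] assms p_gt by (simp add: stationary_def)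
  then have "\<sigma> / p * (p / 2 * t * ((norm y)\<^sup>2 - (norm x)\<^sup>2)) \<le> \<sigma> / p * (norm y powr p - norm x powr p)"
    using \<sigma>_pos p_gt by (intro mult_left_mono) auto
  moreover have "\<sigma> / p * (p / 2 * t * ((norm y)\<^sup>2 - (norm x)\<^sup>2)) = \<sigma> * t / 2 * ((norm y)\<^sup>2 - (norm x)\<^sup>2)"
    using p_gt by simp
  ultimately have "\<sigma> * t / 2 * ((norm y)\<^sup>2 - (norm x)\<^sup>2) \<le> \<sigma> / p * (norm y powr p - norm x powr p)"
    by simp
  moreover have "x + (y - x) = y" by simp
  ultimately show "g x \<le> g y"
    using growth_identity[OF assms(1), of "y - x"] assms(3)[of "y - x"] by (simp only:)
qed

text \<open>Reflecting a stationary point in the hyperplane orthogonal to \<open>d\<close> preserves the norm,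
  so only the quadratic form of the shifted matrix contributes to the change of the objective.\<close>

lemma reflection_growth:
  assumes "stationary x t"
  shows "g (x + (- 2 * (d \<bullet> x) / (d \<bullet> d)) *\<^sub>R d) - g x = 2 * ((d \<bullet> x) / (d \<bullet> d))\<^sup>2 * bil t d d"
proof -
  define k where "k = - 2 * (d \<bullet> x) / (d \<bullet> d)"
  have "(norm (x + k *\<^sub>R d))\<^sup>2 = (norm x)\<^sup>2 + k * (2 * (d \<bullet> x) + k * (d \<bullet> d))"
    by (simp only: power2_norm_eq_inner)
      (simp add: inner_add_left inner_add_right inner_commute[of x d] algebra_simps)
  also have "k * (2 * (d \<bullet> x) + k * (d \<bullet> d)) = 0"
    by (cases "d = 0") (auto simp: k_def)
  finally have "norm (x + k *\<^sub>R d) = norm x"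
    by simp
  then have "g (x + k *\<^sub>R d) - g x = 1 / 2 * k\<^sup>2 * bil t d d"
    using growth_identity[OF assms, of "k *\<^sub>R d"] by (simp add: bil_simps power2_eq_square)
  also have "1 / 2 * k\<^sup>2 = 2 * ((d \<bullet> x) / (d \<bullet> d))\<^sup>2"
    by (simp add: k_def power_divide power_mult_distrib)
  finally show ?thesis by (simp add: k_def)
qed

lemma reflection_bil_nonneg:
  assumes "stationary x t" "d \<bullet> x \<noteq> 0" "g x \<le> g (x + (- 2 * (d \<bullet> x) / (d \<bullet> d)) *\<^sub>R d)"
  shows "bil t d d \<ge> 0"
proof -
  have "d \<noteq> 0" using assms(2) by auto
  then have "2 * ((d \<bullet> x) / (d \<bullet> d))\<^sup>2 > 0" using assms(2) by simp
  moreover have "0 \<le> 2 * ((d \<bullet> x) / (d \<bullet> d))\<^sup>2 * bil t d d"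
    using assms(3) unfolding reflection_growth[OF assms(1), of d, symmetric] by simp
  ultimately show ?thesis
    by (simp add: zero_le_mult_iff)
qed

text \<open>Mirror images of \<open>x\<close> test every direction not orthogonal to
  \<open>x\<close>; an orthogonal \<open>d\<close> is the limit of the admissible directions
  \<open>d + e *\<^sub>R x\<close>.\<close>

lemma global_minimizer_bil_nonneg:
  assumes st: "stationary x t" and "x \<noteq> 0" and "global_minimizer g x"
  shows "bil t d d \<ge> 0"
proof -
  have *: "bil t d d \<ge> 0" if "d \<bullet> x \<noteq> 0" for d
    using reflection_bil_nonneg[OF st that] assms(3) by (simp add: global_minimizer_def)
  show ?thesis
  proof (cases "d \<bullet> x = 0")
    case True
    have "\<forall>\<^sub>F e in at 0. (d + e *\<^sub>R x) \<bullet> x \<noteq> 0"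
      using eventually_neq_at_within[of 0 0 UNIV]
      by eventually_elim (use True \<open>x \<noteq> 0\<close> in \<open>auto simp: inner_add_left\<close>)
    then have "\<forall>\<^sub>F e in at 0. 0 \<le> bil t d d + 2 * e * bil t x d + e\<^sup>2 * bil t x x"
      by eventually_elim (metis * bil_quadratic)
    then show ?thesis by (rule eventually_quadratic_nonneg)
  qed (rule *)
qed

text \<open>Since \<open>d\<close> is orthogonal to \<open>x\<close>, the mirror image of
  \<open>x\<close> with respect to \<open>d + e *\<^sub>R z\<close> tends to \<open>x\<close> as
  \<open>e\<close> tends to 0, so local minimality suffices to compare the two. The term in
  \<open>z\<close> keeps the reflection nontrivial.\<close>

lemma local_minimizer_eventually_bil_nonneg:
  assumes st: "stationary x t" and lm: "local_minimizer g x"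
    and d: "d \<noteq> 0" "d \<bullet> x = 0" and z: "z \<bullet> x \<noteq> 0"
  shows "\<forall>\<^sub>F e in at 0. 0 \<le> bil t d d + 2 * e * bil t z d + e\<^sup>2 * bil t z z"
proof -
  obtain r where r: "r > 0" "\<forall>y\<in>ball x r. g x \<le> g y"
    using lm by (auto simp: local_minimizer_def)
  define D where "D e = d + e *\<^sub>R z" for e
  have D: "(D \<longlongrightarrow> d) (at 0)"
    unfolding D_def by (rule tendsto_eq_intros refl | simp)+
  have "((\<lambda>e. x + (- 2 * (D e \<bullet> x) / (D e \<bullet> D e)) *\<^sub>R D e) \<longlongrightarrow>
      x + (- 2 * (d \<bullet> x) / (d \<bullet> d)) *\<^sub>R d) (at 0)"
    using d by (intro tendsto_intros D) auto
  then have "((\<lambda>e. x + (- 2 * (D e \<bullet> x) / (D e \<bullet> D e)) *\<^sub>R D e) \<longlongrightarrow> x) (at 0)"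
    using d by simp
  then have "\<forall>\<^sub>F e in at 0. x + (- 2 * (D e \<bullet> x) / (D e \<bullet> D e)) *\<^sub>R D e \<in> ball x r"
    using r(1) by (auto simp: tendsto_iff dist_commute)
  moreover have "\<forall>\<^sub>F e in at (0::real). e \<noteq> 0"
    by (simp add: eventually_neq_at_within)
  ultimately show ?thesis
  proof eventually_elim
    case (elim e)
    have "D e \<bullet> x \<noteq> 0" using elim(2) d z by (simp add: D_def inner_add_left)
    then have "bil t (D e) (D e) \<ge> 0"
      using reflection_bil_nonneg[OF st] elim(1) r(2) by blast
    then show ?case by (simp add: D_def bil_quadratic)
  qed
qed

lemma local_minimizer_stationary:
  assumes "local_minimizer g x" "x \<noteq> 0"
  shows "stationary x (norm x powr (p - 2))"
proof -
  define t where "t = norm x powr (p - 2)"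
  \<comment> \<open>This is the gradient at \<open>x\<close>. The derivative of the objective along
    it is \<open>w \<bullet> w\<close>, which must vanish at a local minimizer.\<close>
  define w where "w = H *v x + (\<sigma> * t) *\<^sub>R x + c"
  obtain r where r: "r > 0" "\<forall>y\<in>ball x r. g x \<le> g y"
    using assms by (auto simp: local_minimizer_def)
  have "w \<noteq> 0 \<Longrightarrow> False"
  proof -
    assume "w \<noteq> 0"
    \<comment> \<open>The power of the norm is written as a power of a quadratic polynomial in
      \<open>s\<close>, which is positive at \<open>s = 0\<close> because
      \<open>x \<noteq> 0\<close>.\<close>
    define f where "f s = 1 / 2 * (x \<bullet> (H *v x) + 2 * s * (w \<bullet> (H *v x)) + s\<^sup>2 * (w \<bullet> (H *v w)))
      + c \<bullet> x + s * (c \<bullet> w) + \<sigma> / p * (x \<bullet> x + 2 * s * (w \<bullet> x) + s\<^sup>2 * (w \<bullet> w)) powr (p / 2)" for s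
    have g_f: "g (x + s *\<^sub>R w) = f s" for s
    proof -
      have "norm (x + s *\<^sub>R w) powr p = ((norm (x + s *\<^sub>R w))\<^sup>2) powr (p / 2)"
        by (simp flip: powr_numeral add: powr_powr)
      also have "(norm (x + s *\<^sub>R w))\<^sup>2 = x \<bullet> x + 2 * s * (w \<bullet> x) + s\<^sup>2 * (w \<bullet> w)"
        by (simp only: power2_norm_eq_inner)
          (simp add: inner_add_left inner_add_right inner_commute[of x w] power2_eq_square algebra_simps)
      finally show ?thesis
        using inner_symmetric_matrix[OF sym, of x w]
        by (simp add: regularized_quadratic_def f_def matrix_vector_right_distrib inner_add_left
            inner_add_right inner_commute[of "H *v x"] power2_eq_square algebra_simps)
    qed
    have "(f has_real_derivative w \<bullet> w) (at 0)"
    proof -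
      have "(f has_real_derivative w \<bullet> (H *v x) + c \<bullet> w + \<sigma> / p * ((p / 2) * (x \<bullet> x) powr (p / 2 - 1) * (2 * (w \<bullet> x)))) (at 0)"
        unfolding f_def using assms(2)
        by (auto intro!: derivative_eq_intros simp: power2_eq_square)
      moreover have "(x \<bullet> x) powr (p / 2 - 1) = t"
        unfolding t_def power2_norm_eq_inner[symmetric]
        using assms(2) by (simp flip: powr_numeral add: powr_powr algebra_simps)
      ultimately show ?thesis
        using p_gt by (simp add: w_def inner_add_right inner_commute algebra_simps)
    qed
    moreover have "\<forall>s. \<bar>0 - s\<bar> < r / norm w \<longrightarrow> f 0 \<le> f s"
    proof (intro allI impI)
      fix s assume "\<bar>0 - s\<bar> < r / norm w"
      then have "x + s *\<^sub>R w \<in> ball x r" using \<open>w \<noteq> 0\<close> by (simp add: dist_norm field_simps)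
      then have "g x \<le> g (x + s *\<^sub>R w)" using r(2) by blast
      then show "f 0 \<le> f s" using g_f[of 0] g_f[of s] by simp
    qed
    ultimately have "w \<bullet> w = 0"
      using DERIV_local_min[of f "w \<bullet> w" 0 "r / norm w"] r(1) \<open>w \<noteq> 0\<close> by simp
    then show False using \<open>w \<noteq> 0\<close> by simp
  qed
  then show ?thesis unfolding stationary_def w_def t_def
    by (metis add_eq_0_iff2)
qed

text \<open>Near the origin the term of degree \<open>p > 2\<close> is of higher order, so local
  minimality forces \<open>c = 0\<close> and \<open>H\<close> positive semidefinite. This disposes
  of the point at which the reflection argument has no content.\<close>

lemma local_minimizer_zero_imp_global:
  assumes "local_minimizer g 0"
  shows "global_minimizer g 0"
proof -
  obtain r where r: "r > 0" "\<forall>y\<in>ball 0 r. g 0 \<le> g y"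
    using assms by (auto simp: local_minimizer_def)
  have g0: "g 0 = 0" by (simp add: regularized_quadratic_def)
  \<comment> \<open>For \<open>s > 0\<close> this is \<open>g (s *\<^sub>R d) / s\<close>. Its limit
    gives the sign of \<open>c \<bullet> d\<close>; once \<open>c\<close> is known to vanish,
    another division by \<open>s\<close> isolates the form of \<open>H\<close>.\<close>
  have ev: "\<forall>\<^sub>F s in at_right 0. 0 \<le> 1 / 2 * s * (d \<bullet> (H *v d)) + c \<bullet> d + \<sigma> / p * norm d powr p * s powr (p - 1)"
    (is "eventually ?P _") for d
  proof (cases "d = 0")
    case False
    show ?thesis
    proof (rule eventually_at_rightI[of 0 "r / norm d"])
      fix s assume s: "s \<in> {0<..<r / norm d}"
      then have "s *\<^sub>R d \<in> ball 0 r" using False by (simp add: field_simps)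
      then have "0 \<le> g (s *\<^sub>R d)" using r g0 by simp
      also have "g (s *\<^sub>R d) = s * (1 / 2 * s * (d \<bullet> (H *v d)) + c \<bullet> d + \<sigma> / p * norm d powr p * s powr (p - 1))"
        using s by (simp add: regularized_quadratic_def powr_mult powr_diff algebra_simps)
      finally show "?P s" using s by (simp add: zero_le_mult_iff)
    qed (use r False in auto)
  qed simp
  have cd: "0 \<le> c \<bullet> d" for d
  proof (rule tendsto_lowerbound[OF _ ev])
    have "((\<lambda>s. s powr (p - 1)) \<longlongrightarrow> 0) (at_right 0)"
      using p_gt by (intro tendsto_eq_intros) (auto simp: eventually_at_filter)
    then have "((\<lambda>s. 1 / 2 * s * (d \<bullet> (H *v d)) + c \<bullet> d + \<sigma> / p * norm d powr p * s powr (p - 1)) \<longlongrightarrow>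
      1 / 2 * 0 * (d \<bullet> (H *v d)) + c \<bullet> d + \<sigma> / p * norm d powr p * 0) (at_right 0)"
      by (intro tendsto_intros)
    then show "((\<lambda>s. 1 / 2 * s * (d \<bullet> (H *v d)) + c \<bullet> d + \<sigma> / p * norm d powr p * s powr (p - 1)) \<longlongrightarrow> c \<bullet> d) (at_right 0)"
      by simp
  qed simp
  then have c0: "c \<bullet> d = 0" for d
    using cd[of d] cd[of "- d"] by (simp add: antisym)
  have "0 \<le> 1 / 2 * (d \<bullet> (H *v d))" for d
  proof (rule tendsto_lowerbound)
    show "\<forall>\<^sub>F s in at_right 0. 0 \<le> 1 / 2 * (d \<bullet> (H *v d)) + \<sigma> / p * norm d powr p * s powr (p - 2)"
      using ev[of d] eventually_at_right_less
    proof eventually_elim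
      case (elim s)
      have "s powr (p - 1) = s * s powr (p - 2)"
        using elim(2) by (simp add: powr_diff power2_eq_square)
      then have "0 \<le> s * (1 / 2 * (d \<bullet> (H *v d)) + \<sigma> / p * norm d powr p * s powr (p - 2))"
        using elim(1) c0[of d] by (simp add: algebra_simps)
      then show ?case using elim(2) by (simp add: zero_le_mult_iff)
    qed
    have "((\<lambda>s. s powr (p - 2)) \<longlongrightarrow> 0) (at_right 0)"
      using p_gt by (intro tendsto_eq_intros) (auto simp: eventually_at_filter)
    then have "((\<lambda>s. 1 / 2 * (d \<bullet> (H *v d)) + \<sigma> / p * norm d powr p * s powr (p - 2)) \<longlongrightarrow>
      1 / 2 * (d \<bullet> (H *v d)) + \<sigma> / p * norm d powr p * 0) (at_right 0)"
      by (intro tendsto_intros)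
    then show "((\<lambda>s. 1 / 2 * (d \<bullet> (H *v d)) + \<sigma> / p * norm d powr p * s powr (p - 2)) \<longlongrightarrow> 1 / 2 * (d \<bullet> (H *v d))) (at_right 0)"
      by simp
  qed simp
  then show ?thesis
    using \<sigma>_pos p_gt unfolding global_minimizer_def g0
    by (simp add: regularized_quadratic_def c0)
qed

end

subsection \<open>The secular function in an eigenbasis\<close>

lemma matrix_inv_right:
  fixes A :: "'a::semiring_1^'n^'m"
  shows "invertible A \<Longrightarrow> A ** matrix_inv A = mat 1"
  unfolding matrix_inv_def invertible_def by (rule someI2_ex) auto

lemma has_real_derivative_inverse_power:
  fixes a b r t :: real
  assumes "b + r * t \<noteq> 0"
  shows "((\<lambda>s. a / (b + r * s) ^ m) has_real_derivative - (real m * r * a / (b + r * t) ^ Suc m)) (at t)"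
proof (cases m)
  case (Suc l)
  have "((\<lambda>s. a / (b + r * s) ^ m) has_real_derivative
      (0 * (b + r * t) ^ m - a * (real m * (r * (b + r * t) ^ (m - 1)))) / ((b + r * t) ^ m * (b + r * t) ^ m)) (at t)"
    using assms by (auto intro!: derivative_eq_intros)
  moreover have "(0 * (b + r * t) ^ m - a * (real m * (r * (b + r * t) ^ (m - 1)))) / ((b + r * t) ^ m * (b + r * t) ^ m)
      = - (real m * r * a / (b + r * t) ^ Suc m)"
    using assms by (simp add: Suc)
  ultimately show ?thesis by simp
qed simp

section \<open>Coordinates in an eigenbasis and the secular interval\<close>

locale diagonalized_problem = regularized_problem H c \<sigma> p
  for H :: "real^'n^'n" and c :: "real^'n" and \<sigma> p :: real +
  fixes n :: nat and \<alpha> :: "nat \<Rightarrow> real" and v :: "nat \<Rightarrow> real^'n"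
  assumes n_def: "n = CARD('n)"
    and mono: "mono_on {1..n} \<alpha>"
    and ortho: "\<And>i j. i \<in> {1..n} \<Longrightarrow> j \<in> {1..n} \<Longrightarrow> v i \<bullet> v j = (if i = j then 1 else 0)"
    and eigen: "\<And>i. i \<in> {1..n} \<Longrightarrow> H *v v i = \<alpha> i *\<^sub>R v i"
    and expand: "\<And>y. y = (\<Sum>i=1..n. (y \<bullet> v i) *\<^sub>R v i)"
begin

abbreviation N :: "nat set" where "N \<equiv> {1..n}"

abbreviation \<mu> :: "real \<Rightarrow> nat \<Rightarrow> real" where "\<mu> t k \<equiv> \<alpha> k + \<sigma> * t"

abbreviation h :: "real \<Rightarrow> real" where "h \<equiv> secular_function H c \<sigma> p"

abbreviation \<gamma> :: "nat \<Rightarrow> real" where "\<gamma> k \<equiv> c \<bullet> v k"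

lemma one_in_N: "1 \<in> N"
  by (simp add: n_def Suc_le_eq)

lemma inner_coords: "a \<bullet> b = (\<Sum>k\<in>N. (a \<bullet> v k) * (b \<bullet> v k))"
  by (subst expand[of b]) (simp add: inner_sum_right mult.commute)

lemma coords_eqI: "(\<And>k. k \<in> N \<Longrightarrow> a \<bullet> v k = b \<bullet> v k) \<Longrightarrow> a = b"
  by (subst expand[of a], subst expand[of b]) simp

lemma matrix_coords: "k \<in> N \<Longrightarrow> (H *v y) \<bullet> v k = \<alpha> k * (y \<bullet> v k)"
  by (simp add: inner_symmetric_matrix[OF sym] eigen)

lemma bil_coords: "bil t a b = (\<Sum>k\<in>N. \<mu> t k * (a \<bullet> v k) * (b \<bullet> v k))"
proof -
  have "a \<bullet> (H *v b) = (\<Sum>k\<in>N. \<alpha> k * (a \<bullet> v k) * (b \<bullet> v k))"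
    unfolding inner_coords[of a "H *v b"] by (intro sum.cong) (simp_all only: matrix_coords mult_ac)
  moreover have "\<sigma> * t * (a \<bullet> b) = (\<Sum>k\<in>N. \<sigma> * t * (a \<bullet> v k) * (b \<bullet> v k))"
    unfolding inner_coords[of a b] sum_distrib_left by (simp only: mult.assoc)
  ultimately show ?thesis
    by (simp only: bil_def distrib_right sum.distrib)
qed

lemma bil_eigenvector: "k \<in> N \<Longrightarrow> bil t d (v k) = \<mu> t k * (d \<bullet> v k)"
  by (simp add: bil_def eigen algebra_simps)

lemma eigenvalue_le: "i \<in> N \<Longrightarrow> j \<in> N \<Longrightarrow> i \<le> j \<Longrightarrow> \<alpha> i \<le> \<alpha> j"
  using mono by (auto simp: mono_on_def)

text \<open>The secular interval read off the shifted eigenvalues. For \<open>n = 1\<close> the last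
  condition is vacuous, in agreement with an infinite second eigenvalue.\<close>

definition dom :: "real \<Rightarrow> bool" where
  "dom t \<longleftrightarrow> t > 0 \<and> \<mu> t 1 < 0 \<and> (\<forall>k\<in>N - {1}. \<mu> t k > 0)"

lemma secular_domain_iff: "t \<in> secular_domain n \<alpha> \<sigma> \<longleftrightarrow> dom t"
proof (cases "n = 1")
  case True
  have "- (\<infinity> :: ereal) / ereal \<sigma> = - \<infinity>"
    using \<sigma>_pos by (simp add: divide_ereal_def)
  then show ?thesis using True \<sigma>_pos
    unfolding dom_def by (auto simp: secular_domain_def second_eigenvalue_def field_simps)
next
  case False
  then have "2 \<in> N" using one_in_N by auto
  have "(\<forall>k\<in>N - {1}. \<mu> t k > 0) \<longleftrightarrow> \<mu> t 2 > 0"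
  proof
    assume "\<mu> t 2 > 0"
    show "\<forall>k\<in>N - {1}. \<mu> t k > 0"
    proof
      fix k assume "k \<in> N - {1}"
      then have "\<alpha> 2 \<le> \<alpha> k" using \<open>2 \<in> N\<close> by (intro eigenvalue_le) auto
      then show "\<mu> t k > 0" using \<open>\<mu> t 2 > 0\<close> by simp
    qed
  qed (use \<open>2 \<in> N\<close> in auto)
  moreover have "- ereal (\<alpha> 2) / ereal \<sigma> < ereal t \<longleftrightarrow> \<mu> t 2 > 0" "t < - \<alpha> 1 / \<sigma> \<longleftrightarrow> \<mu> t 1 < 0"
    using \<sigma>_pos by (auto simp: field_simps)
  ultimately show ?thesis using False
    by (auto simp only: secular_domain_def second_eigenvalue_def dom_def max_less_iff_conj
        mem_Collect_eq if_False ereal_less)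
qed

lemma dom_nonzero: "dom t \<Longrightarrow> k \<in> N \<Longrightarrow> \<mu> t k \<noteq> 0"
  unfolding dom_def by (metis DiffI less_irrefl singletonD)

lemma dom_open: "dom t \<Longrightarrow> eventually dom (nhds t)"
proof -
  assume "dom t"
  have lim: "((\<lambda>s. \<mu> s k) \<longlongrightarrow> \<mu> t k) (nhds t)" for k
    by (intro tendsto_intros filterlim_ident)
  have "\<forall>\<^sub>F s in nhds t. s > 0 \<and> \<mu> s 1 < 0 \<and> (\<forall>k\<in>N - {1}. \<mu> s k > 0)"
    using \<open>dom t\<close> order_tendstoD(1)[OF lim] order_tendstoD(2)[OF lim]
    by (intro eventually_conj eventually_ball_finite ballI eventually_nhds_in_open[of "{0<..}", simplified])
      (auto simp: dom_def)
  then show ?thesis by (rule eventually_mono) (unfold dom_def, assumption)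
qed

lemma shifted_inverse_mult:
  assumes "\<And>k. k \<in> N \<Longrightarrow> \<mu> t k \<noteq> 0"
  shows "(H + (\<sigma> * t) *\<^sub>R mat 1) *v (shifted_inverse H \<sigma> t *v y) = y"
proof -
  have "d = 0" if "(H + (\<sigma> * t) *\<^sub>R mat 1) *v d = 0" for d
  proof (rule coords_eqI)
    fix k assume k: "k \<in> N"
    have "0 = ((H + (\<sigma> * t) *\<^sub>R mat 1) *v d) \<bullet> v k" using that by simp
    also have "\<dots> = \<mu> t k * (d \<bullet> v k)"
      by (simp add: matrix_vector_mult_add_rdistrib scaleR_matrix_vector_assoc[symmetric]
          inner_add_left matrix_coords[OF k] algebra_simps)
    finally show "d \<bullet> v k = 0 \<bullet> v k" using assms[OF k] by simp
  qed
  then have "invertible (H + (\<sigma> * t) *\<^sub>R mat 1)"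
    unfolding invertible_left_inverse matrix_left_invertible_ker by blast
  then show ?thesis
    by (simp add: shifted_inverse_def matrix_vector_mul_assoc matrix_inv_right)
qed

lemma shifted_inverse_coords:
  assumes "\<And>k. k \<in> N \<Longrightarrow> \<mu> t k \<noteq> 0" and k: "k \<in> N"
  shows "(shifted_inverse H \<sigma> t *v y) \<bullet> v k = (y \<bullet> v k) / \<mu> t k"
proof -
  let ?w = "shifted_inverse H \<sigma> t *v y"
  have "y \<bullet> v k = ((H + (\<sigma> * t) *\<^sub>R mat 1) *v ?w) \<bullet> v k"
    using shifted_inverse_mult[OF assms(1)] by simp
  also have "\<dots> = \<mu> t k * (?w \<bullet> v k)"
    by (simp add: matrix_vector_mult_add_rdistrib scaleR_matrix_vector_assoc[symmetric]
        inner_add_left matrix_coords[OF k] algebra_simps)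
  finally show ?thesis using assms by simp
qed

lemma bil_shifted_inverse:
  assumes "\<And>k. k \<in> N \<Longrightarrow> \<mu> t k \<noteq> 0"
  shows "bil t d (shifted_inverse H \<sigma> t *v y) = d \<bullet> y"
  unfolding bil_coords inner_coords[of d y]
proof (intro sum.cong refl)
  fix k assume "k \<in> N"
  with assms[OF this] shifted_inverse_coords[OF assms this]
  show "\<mu> t k * (d \<bullet> v k) * ((shifted_inverse H \<sigma> t *v y) \<bullet> v k) = (d \<bullet> v k) * (y \<bullet> v k)"
    by simp
qed

section \<open>The curve of candidate points and the derivatives of the secular function\<close>

definition y :: "real \<Rightarrow> real^'n" where "y t = - (shifted_inverse H \<sigma> t *v c)"

text \<open>On the secular interval this is the squared norm of \<open>y t\<close> in
  eigencoordinates; the next two definitions are its first and second derivatives in closed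
  form.\<close>

definition \<psi> :: "real \<Rightarrow> real" where "\<psi> t = (\<Sum>k\<in>N. (\<gamma> k)\<^sup>2 / (\<mu> t k)^2)"
definition \<psi>' :: "real \<Rightarrow> real" where "\<psi>' t = - 2 * \<sigma> * (\<Sum>k\<in>N. (\<gamma> k)\<^sup>2 / (\<mu> t k)^3)"
definition \<psi>'' :: "real \<Rightarrow> real" where "\<psi>'' t = 6 * \<sigma>\<^sup>2 * (\<Sum>k\<in>N. (\<gamma> k)\<^sup>2 / (\<mu> t k)^4)"

lemma y_coords: "dom t \<Longrightarrow> k \<in> N \<Longrightarrow> y t \<bullet> v k = - \<gamma> k / \<mu> t k"
  using shifted_inverse_coords[OF dom_nonzero, of t k c] by (simp add: y_def)

lemma norm_y: "dom t \<Longrightarrow> (norm (y t))\<^sup>2 = \<psi> t"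
  unfolding power2_norm_eq_inner \<psi>_def inner_coords[of "y t" "y t"]
  by (intro sum.cong) (auto simp: y_coords power2_eq_square)

definition q :: real where "q = 2 / (p - 2)"

lemma q_pos: "q > 0"
  using p_gt by (simp add: q_def)

lemma secular_eq: "dom t \<Longrightarrow> h t = \<psi> t - t powr q"
  using norm_y[of t] by (simp add: secular_function_def y_def q_def)

lemma \<psi>_deriv: "dom t \<Longrightarrow> (\<psi> has_real_derivative \<psi>' t) (at t)"
proof -
  assume t: "dom t"
  have "(\<psi> has_real_derivative (\<Sum>k\<in>N. - (real 2 * \<sigma> * (\<gamma> k)\<^sup>2 / \<mu> t k ^ Suc 2))) (at t)"
    unfolding \<psi>_def by (intro DERIV_sum has_real_derivative_inverse_power dom_nonzero t)
  then show ?thesis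
    by (simp add: \<psi>'_def sum_distrib_left sum_negf eval_nat_numeral mult.assoc)
qed

lemma \<psi>'_deriv: "dom t \<Longrightarrow> (\<psi>' has_real_derivative \<psi>'' t) (at t)"
proof -
  assume t: "dom t"
  have "(\<psi>' has_real_derivative - 2 * \<sigma> * (\<Sum>k\<in>N. - (real 3 * \<sigma> * (\<gamma> k)\<^sup>2 / \<mu> t k ^ Suc 3))) (at t)"
    unfolding \<psi>'_def by (intro DERIV_cmult DERIV_sum has_real_derivative_inverse_power dom_nonzero t)
  moreover have "- 2 * \<sigma> * (\<Sum>k\<in>N. - (real 3 * \<sigma> * (\<gamma> k)\<^sup>2 / \<mu> t k ^ Suc 3)) = \<psi>'' t"
    unfolding \<psi>''_def sum_distrib_left by (intro sum.cong) (auto simp: power2_eq_square eval_nat_numeral)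
  ultimately show ?thesis by simp
qed

definition h' :: "real \<Rightarrow> real" where "h' t = \<psi>' t - q * t powr (q - 1)"

lemma secular_deriv:
  assumes "dom t"
  shows "(h has_real_derivative h' t) (at t)"
proof -
  have "((\<lambda>s. \<psi> s - s powr q) has_real_derivative h' t) (at t)"
    unfolding h'_def using assms
    by (auto intro!: derivative_eq_intros \<psi>_deriv simp: dom_def)
  moreover have "\<forall>\<^sub>F s in nhds t. h s = \<psi> s - s powr q"
    using dom_open[OF assms] by eventually_elim (rule secular_eq)
  ultimately show ?thesis
    using DERIV_cong_ev[of t t h "\<lambda>s. \<psi> s - s powr q" "h' t" "h' t"] by simp
qed

lemma deriv_secular: "dom t \<Longrightarrow> deriv h t = h' t"
  using secular_deriv by (rule DERIV_imp_deriv)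

lemma secular_deriv2:
  assumes "dom t"
  shows "(h' has_real_derivative \<psi>'' t - q * (q - 1) * t powr (q - 2)) (at t)"
proof -
  have "q - 1 - 1 = q - 2" by simp
  then show ?thesis
    unfolding h'_def using assms
    by (auto intro!: derivative_eq_intros \<psi>'_deriv simp: dom_def)
qed

text \<open>The three sums carry the powers 2, 3 and 4 of the shifted eigenvalues, so Cauchy-Schwarz
  applies to \<open>\<gamma> k / \<mu> t k\<close> and \<open>\<gamma> k / (\<mu> t k)^2\<close>.
  The factor 3/2 is \<open>6 * \<sigma>\<^sup>2\<close> divided by
  \<open>(2 * \<sigma>)\<^sup>2\<close>.\<close>

lemma \<psi>_\<psi>''_ge: "3 / 2 * (\<psi>' t)\<^sup>2 \<le> \<psi> t * \<psi>'' t"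
proof -
  have "(\<Sum>k\<in>N. (\<gamma> k)\<^sup>2 / (\<mu> t k)^3)\<^sup>2 = (\<Sum>k\<in>N. (\<gamma> k / \<mu> t k) * (\<gamma> k / (\<mu> t k)^2))\<^sup>2"
    by (simp add: power2_eq_square power3_eq_cube mult.assoc)
  also have "\<dots> \<le> (\<Sum>k\<in>N. (\<gamma> k / \<mu> t k)\<^sup>2) * (\<Sum>k\<in>N. (\<gamma> k / (\<mu> t k)^2)\<^sup>2)"
    by (rule Cauchy_Schwarz_ineq_sum)
  also have "\<dots> = (\<Sum>k\<in>N. (\<gamma> k)\<^sup>2 / (\<mu> t k)^2) * (\<Sum>k\<in>N. (\<gamma> k)\<^sup>2 / (\<mu> t k)^4)"
    by (simp add: power_divide flip: power_mult)
  finally have "6 * \<sigma>\<^sup>2 * (\<Sum>k\<in>N. (\<gamma> k)\<^sup>2 / (\<mu> t k)^3)\<^sup>2 \<le>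
      6 * \<sigma>\<^sup>2 * ((\<Sum>k\<in>N. (\<gamma> k)\<^sup>2 / (\<mu> t k)^2) * (\<Sum>k\<in>N. (\<gamma> k)\<^sup>2 / (\<mu> t k)^4))"
    by (intro mult_left_mono) auto
  then show ?thesis
    by (simp add: \<psi>_def \<psi>'_def \<psi>''_def power_mult_distrib mult_ac)
qed

text \<open>At a double root \<open>\<psi>\<close> and \<open>\<psi>'\<close> agree with
  \<open>t powr q\<close> and its derivative. The Cauchy-Schwarz bound then gives the coefficient
  \<open>3 / 2 * q\<^sup>2\<close> for \<open>\<psi>''\<close>, which exceeds
  \<open>q * (q - 1)\<close> for every positive \<open>q\<close>.\<close>

lemma secular_degenerate_root_convex:
  assumes "dom t" "h t = 0" "h' t = 0"
  shows "\<psi>'' t - q * (q - 1) * t powr (q - 2) > 0"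
proof -
  have t: "t > 0" and q: "q > 0" using assms q_pos by (auto simp: dom_def)
  have \<psi>: "\<psi> t = t powr q" and \<psi>': "\<psi>' t = q * t powr (q - 1)"
    using assms secular_eq[of t] by (auto simp: h'_def)
  have sq: "(t powr (q - 1))\<^sup>2 = t powr q * t powr (q - 2)"
    using t by (simp add: power2_eq_square flip: powr_add)
  have "t powr q * (q * (q - 1) * t powr (q - 2)) = q * (q - 1) * (t powr (q - 1))\<^sup>2"
    by (simp add: sq)
  also have "\<dots> < 3 / 2 * q\<^sup>2 * (t powr (q - 1))\<^sup>2"
  proof (rule mult_strict_right_mono)
    have "0 < q\<^sup>2 / 2 + q" using q by (intro add_nonneg_pos) auto
    also have "\<dots> = 3 / 2 * q\<^sup>2 - q * (q - 1)" by (simp add: power2_eq_square right_diff_distrib)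
    finally show "q * (q - 1) < 3 / 2 * q\<^sup>2" by simp
  qed (use t in simp)
  also have "\<dots> = 3 / 2 * (\<psi>' t)\<^sup>2" by (simp add: \<psi>' power_mult_distrib)
  also have "\<dots> \<le> t powr q * \<psi>'' t" using \<psi>_\<psi>''_ge[of t] by (simp add: \<psi>)
  finally have "t powr q * (q * (q - 1) * t powr (q - 2)) < t powr q * \<psi>'' t" .
  then show ?thesis using t by simp
qed

end

subsection \<open>Sufficiency\<close>

lemma power2_powr: "0 \<le> r \<Longrightarrow> (r\<^sup>2) powr a = r powr (2 * a)" for r a :: real
  by (cases "r = 0") (simp_all flip: powr_numeral add: powr_powr)

lemma second_derivative_test:
  fixes f :: "real \<Rightarrow> real"
  assumes D: "\<forall>\<^sub>F u in nhds a. (f has_real_derivative f' u) (at u)"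
    and "f' a = 0" and D2: "(f' has_real_derivative l) (at a)" and "l > 0"
  shows "\<forall>\<^sub>F u in at a. f a < f u"
proof -
  obtain e where e: "e > 0" "\<And>u. dist u a < e \<Longrightarrow> (f has_real_derivative f' u) (at u)"
    using D by (auto simp: eventually_nhds_metric)
  obtain r where r: "r > 0" "\<And>k. 0 < k \<Longrightarrow> k < r \<Longrightarrow> 0 < f' (a + k)"
    using DERIV_pos_inc_right[OF D2 \<open>l > 0\<close>] \<open>f' a = 0\<close> by metis
  obtain s where s: "s > 0" "\<And>k. 0 < k \<Longrightarrow> k < s \<Longrightarrow> f' (a - k) < 0"
    using DERIV_pos_inc_left[OF D2 \<open>l > 0\<close>] \<open>f' a = 0\<close> by metis
  have "f a < f u" if u: "u \<noteq> a" "dist u a < Min {e, r, s}" for u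
  proof (cases "a < u")
    case True
    have "\<exists>z>a. z < u \<and> f u - f a = (u - a) * f' z"
      using u True by (intro MVT2 e) (auto simp: dist_real_def)
    then obtain z where z: "a < z" "z < u" "f u - f a = (u - a) * f' z" by blast
    have "0 < f' z" using r(2)[of "z - a"] z u by (auto simp: dist_real_def)
    then show ?thesis using z by (metis diff_gt_0_iff_gt less_trans mult_pos_pos)
  next
    case False
    then have "u < a" using u by simp
    then have "\<exists>z>u. z < a \<and> f a - f u = (a - u) * f' z"
      using u by (intro MVT2 e) (auto simp: dist_real_def)
    then obtain z where z: "u < z" "z < a" "f a - f u = (a - u) * f' z" by blast
    have "f' z < 0" using s(2)[of "a - z"] z u by (auto simp: dist_real_def)
    then have "(a - u) * f' z < 0" using \<open>u < a\<close> by (simp add: mult_pos_neg)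
    then show ?thesis using z by simp
  qed
  moreover have "Min {e, r, s} > 0" using e r s by simp
  ultimately show ?thesis unfolding eventually_at by blast
qed

lemma eventually_less_at_right:
  fixes f :: "real \<Rightarrow> real"
  assumes D: "\<forall>\<^sub>F u in nhds a. (f has_real_derivative f' u) (at u)"
    and neg: "\<forall>\<^sub>F u in at_right a. f' u < 0"
  shows "\<forall>\<^sub>F u in at_right a. f u < f a"
proof -
  obtain e where e: "e > 0" "\<And>u. dist u a < e \<Longrightarrow> (f has_real_derivative f' u) (at u)"
    using D by (auto simp: eventually_nhds_metric)
  obtain b where b: "b > a" "\<And>u. a < u \<Longrightarrow> u < b \<Longrightarrow> f' u < 0"
    using neg by (auto simp: eventually_at_right_field)
  have "f u < f a" if u: "a < u" "u < min b (a + e)" for u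
  proof -
    have "\<exists>z>a. z < u \<and> f u - f a = (u - a) * f' z"
      using u by (intro MVT2 e) (auto simp: dist_real_def)
    then obtain z where z: "a < z" "z < u" "f u - f a = (u - a) * f' z" by blast
    have "f' z < 0" using b(2) z u by simp
    then have "(u - a) * f' z < 0" using u by (simp add: mult_pos_neg)
    then show ?thesis using z by simp
  qed
  then show ?thesis
    using b(1) e(1) unfolding eventually_at_right_field by (intro exI[of _ "min b (a + e)"]) auto
qed

lemma eventually_less_at_left:
  fixes f :: "real \<Rightarrow> real"
  assumes D: "\<forall>\<^sub>F u in nhds a. (f has_real_derivative f' u) (at u)"
    and pos: "\<forall>\<^sub>F u in at_left a. f' u > 0"
  shows "\<forall>\<^sub>F u in at_left a. f u < f a"
proof -
  obtain e where e: "e > 0" "\<And>u. dist u a < e \<Longrightarrow> (f has_real_derivative f' u) (at u)"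
    using D by (auto simp: eventually_nhds_metric)
  obtain b where b: "b < a" "\<And>u. b < u \<Longrightarrow> u < a \<Longrightarrow> f' u > 0"
    using pos by (auto simp: eventually_at_left_field)
  have "f u < f a" if u: "u < a" "max b (a - e) < u" for u
  proof -
    have "\<exists>z>u. z < a \<and> f a - f u = (a - u) * f' z"
      using u by (intro MVT2 e) (auto simp: dist_real_def)
    then obtain z where z: "u < z" "z < a" "f a - f u = (a - u) * f' z" by blast
    have "f' z > 0" using b(2) z u by simp
    then have "(a - u) * f' z > 0" using u by simp
    then show ?thesis using z by simp
  qed
  then show ?thesis
    using b(1) e(1) unfolding eventually_at_left_field by (intro exI[of _ "max b (a - e)"]) auto
qed

section \<open>Roots of the secular function as stationary points, and the Hessian there\<close>

context diagonalized_problem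
begin

lemma v_1_inner_self: "v 1 \<bullet> v 1 = 1" and v_inner_self: "k \<in> N \<Longrightarrow> v k \<bullet> v k = 1"
  and v_inner_v_1: "k \<in> N - {1} \<Longrightarrow> v k \<bullet> v 1 = 0"
  using ortho[of 1 1] ortho[of k k] ortho[of k 1] one_in_N by (simp_all del: atLeastAtMost_iff)

lemma bil_y: "dom t \<Longrightarrow> bil t d (y t) = - (c \<bullet> d)"
  using bil_shifted_inverse[of t d c] dom_nonzero[of t] bil_scale_right[of t d "-1" "shifted_inverse H \<sigma> t *v c"]
  by (simp add: y_def inner_commute)

lemma p_minus_2_mult_q: "(p - 2) * q = 2"
  using p_gt by (simp add: q_def field_simps)

text \<open>A root satisfies \<open>(norm (y t))\<^sup>2 = t powr q\<close>. As
  \<open>(p - 2) * q = 2\<close>, raising this to the power \<open>(p - 2) / 2\<close> recovers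
  \<open>t\<close> as the multiplier of \<open>y t\<close>.\<close>

lemma stationary_y:
  assumes t: "dom t" and "h t = 0"
  shows "stationary (y t) t" and "y t \<noteq> 0"
proof -
  have "t > 0" using t by (simp add: dom_def)
  have eq: "(norm (y t))\<^sup>2 = t powr q"
    using assms norm_y secular_eq by simp
  then show "y t \<noteq> 0" using \<open>t > 0\<close> by auto
  then have "norm (y t) powr (p - 2) = ((norm (y t))\<^sup>2) powr ((p - 2) / 2)"
    by (simp only: power2_powr norm_ge_zero times_divide_eq_right nonzero_mult_div_cancel_left[of 2] zero_neq_numeral not_False_eq_True)
  also have "\<dots> = t"
  proof -
    have "q * ((p - 2) / 2) = (p - 2) * q / 2" by (simp only: times_divide_eq_right mult.commute)
    then show ?thesis
      unfolding eq powr_powr p_minus_2_mult_q using \<open>t > 0\<close> by simp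
  qed
  finally have "t = norm (y t) powr (p - 2)" by simp
  moreover have "H *v y t + (\<sigma> * t) *\<^sub>R y t = - c"
    using shifted_inverse_mult[OF dom_nonzero[OF t], of "- c"]
    by (simp add: y_def matrix_vector_mult_add_rdistrib scaleR_matrix_vector_assoc[symmetric] vec.neg)
  ultimately show "stationary (y t) t" by (simp add: stationary_def)
qed

lemma stationary_imp_root:
  assumes st: "stationary x t" and t: "dom t"
  shows "x = y t" and "h t = 0"
proof -
  show x: "x = y t"
  proof (rule coords_eqI)
    fix k assume k: "k \<in> N"
    have "\<mu> t k * (x \<bullet> v k) = - \<gamma> k"
      using stationary_bil[OF st, of "v k"] bil_eigenvector[OF k, of t x] by (simp add: bil_commute)
    then show "x \<bullet> v k = y t \<bullet> v k"
      unfolding y_coords[OF t k] using dom_nonzero[OF t k]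
      by (metis nonzero_mult_div_cancel_left)
  qed
  have "t > 0" using t by (simp add: dom_def)
  then have "x \<noteq> 0" using st by (auto simp: stationary_def)
  have "t = norm x powr (p - 2)" using st by (simp add: stationary_def)
  then have "t powr q = (norm x)\<^sup>2"
    using \<open>x \<noteq> 0\<close> by (simp only: powr_powr p_minus_2_mult_q) simp
  then show "h t = 0"
    using secular_eq[OF t] norm_y[OF t] x by simp
qed

text \<open>Up to the factor \<open>- \<sigma>\<close> this is the velocity of the curve
  \<open>y\<close> on the secular interval, which explains the formula for \<open>\<psi>'\<close>
  below.\<close>

definition w :: "real \<Rightarrow> real^'n" where "w t = shifted_inverse H \<sigma> t *v y t"

lemma bil_w: "dom t \<Longrightarrow> bil t d (w t) = d \<bullet> y t"
  unfolding w_def by (rule bil_shifted_inverse) (rule dom_nonzero)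

lemma w_coords: "dom t \<Longrightarrow> k \<in> N \<Longrightarrow> w t \<bullet> v k = (y t \<bullet> v k) / \<mu> t k"
  unfolding w_def by (rule shifted_inverse_coords) (rule dom_nonzero)

lemma \<psi>'_eq: "dom t \<Longrightarrow> \<psi>' t = - 2 * \<sigma> * (w t \<bullet> y t)"
  unfolding \<psi>'_def inner_coords[of "w t" "y t"]
  by (intro arg_cong2[where f = "(*)"] refl sum.cong)
    (simp only: w_coords y_coords, simp add: power2_eq_square power3_eq_cube)

text \<open>The Hessian of the objective at a stationary point \<open>x\<close> is the shifted matrix plus \<open>\<beta> x\<close> times \<open>x x\<^sup>T\<close>.\<close>

definition \<beta> :: "real^'n \<Rightarrow> real" where "\<beta> x = \<sigma> * (p - 2) * norm x powr (p - 4)"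

lemma \<beta>_pos: "x \<noteq> 0 \<Longrightarrow> \<beta> x > 0"
  using \<sigma>_pos p_gt by (simp add: \<beta>_def)

text \<open>Substituting \<open>t = norm (y t) powr (p - 2)\<close> turns the derivative of
  \<open>t powr q\<close> into \<open>2 * \<sigma> / \<beta> (y t)\<close>. The sign of
  \<open>h'\<close> thereby becomes a condition on the Hessian.\<close>

lemma h'_eq:
  assumes t: "dom t" and "h t = 0"
  shows "h' t = - 2 * \<sigma> * (w t \<bullet> y t + 1 / \<beta> (y t))"
proof -
  note st = stationary_y[OF assms]
  have "t = norm (y t) powr (p - 2)" using st by (simp add: stationary_def)
  then have "t powr (q - 1) = norm (y t) powr ((p - 2) * (q - 1))"
    by (metis powr_powr)
  also have "(p - 2) * (q - 1) = - (p - 4)"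
    using p_gt by (simp add: q_def field_simps)
  finally have "t powr (q - 1) = inverse (norm (y t) powr (p - 4))"
    by (simp only: powr_minus)
  then have "q * t powr (q - 1) = 2 * \<sigma> * (1 / \<beta> (y t))"
    using \<sigma>_pos by (simp only: q_def \<beta>_def) (simp add: inverse_eq_divide)
  then show ?thesis
    unfolding h'_def \<psi>'_eq[OF t] by (simp add: algebra_simps)
qed

lemma bil_pos_of_orthogonal:
  assumes t: "dom t" and z: "z \<bullet> v 1 = 0" "z \<noteq> 0"
  shows "bil t z z > 0"
proof -
  have "\<exists>k\<in>N. z \<bullet> v k \<noteq> 0"
    using coords_eqI[of z 0] z(2) by (metis inner_zero_left)
  then obtain k where k: "k \<in> N" "z \<bullet> v k \<noteq> 0" by blast
  then have k1: "k \<in> N - {1}" using z by auto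
  have nn: "0 \<le> \<mu> t i * (z \<bullet> v i) * (z \<bullet> v i)" if "i \<in> N" for i
  proof (cases "i = 1")
    case False
    then have "0 < \<mu> t i" using t that by (auto simp: dom_def)
    then show ?thesis by (simp add: mult.assoc)
  qed (use z in simp)
  have "0 < \<mu> t k" using t k1 unfolding dom_def by blast
  then have "0 < \<mu> t k * (z \<bullet> v k) * (z \<bullet> v k)"
    using k by (metis mult.assoc mult_pos_pos not_square_less_zero linorder_neqE_linordered_idom mult_eq_0_iff)
  also have "\<dots> \<le> bil t z z"
    unfolding bil_coords by (rule member_le_sum[OF k(1)]) (use nn in auto)
  finally show ?thesis .
qed

text \<open>By \<open>bil_w\<close>, \<open>e\<close> and \<open>w t\<close> are orthogonal for the
  form, and \<open>w t\<close> is a negative direction. If \<open>e\<close> were not positive, the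
  form would be nonpositive on the plane they span, but that plane meets the complement of
  \<open>v 1\<close>, where the form is positive definite.\<close>

lemma bil_pos_of_orthogonal_to_negative:
  assumes t: "dom t" and s: "w t \<bullet> y t < 0" and e: "e \<bullet> y t = 0" "e \<noteq> 0"
  shows "bil t e e > 0"
proof (rule ccontr)
  assume "\<not> bil t e e > 0"
  then have le: "bil t e e \<le> 0" by simp
  then have "e \<bullet> v 1 \<noteq> 0"
    using bil_pos_of_orthogonal[OF t _ e(2)] by force
  \<comment> \<open>The combination of \<open>e\<close> and \<open>w t\<close> whose coordinate
    along \<open>v 1\<close> cancels.\<close>
  define z where "z = (w t \<bullet> v 1) *\<^sub>R e + (- (e \<bullet> v 1)) *\<^sub>R w t"
  have "z \<bullet> v 1 = 0" by (simp add: z_def inner_add_left inner_diff_left)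
  then have "bil t z z \<ge> 0"
    using bil_pos_of_orthogonal[OF t, of z] by (cases "z = 0") (auto simp: bil_def)
  moreover have "bil t z z = (w t \<bullet> v 1)\<^sup>2 * bil t e e + (e \<bullet> v 1)\<^sup>2 * (w t \<bullet> y t)"
    using e(1) unfolding z_def bil_simps bil_w[OF t] bil_commute[of t "w t" e]
    by (simp add: power2_eq_square)
  moreover have "(w t \<bullet> v 1)\<^sup>2 * bil t e e \<le> 0" using le by (simp add: mult_nonneg_nonpos)
  moreover have "(e \<bullet> v 1)\<^sup>2 * (w t \<bullet> y t) < 0"
    using s \<open>e \<bullet> v 1 \<noteq> 0\<close> by (simp add: mult_pos_neg)
  ultimately show False by linarith
qed

text \<open>Splitting \<open>d\<close> into a multiple of \<open>w t\<close> and a part orthogonal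
  to \<open>y t\<close> decouples the Hessian. The orthogonal part is positive by the previous
  lemma; the other contributes \<open>s * (1 + \<beta> (y t) * s)\<close>, a product of two negative
  numbers.\<close>

lemma hessian_pos:
  assumes t: "dom t" and root: "h t = 0" and pos: "h' t > 0" and "d \<noteq> 0"
  shows "bil t d d + \<beta> (y t) * (d \<bullet> y t)\<^sup>2 > 0"
proof -
  define s where "s = w t \<bullet> y t"
  have b: "\<beta> (y t) > 0" using \<beta>_pos stationary_y[OF t root] by blast
  have "s + 1 / \<beta> (y t) < 0"
    using pos \<sigma>_pos unfolding h'_eq[OF t root] s_def[symmetric] by (simp add: mult_less_0_iff)
  then have "\<beta> (y t) * (s + 1 / \<beta> (y t)) < 0"
    using b by (simp add: mult_pos_neg)
  then have bs: "1 + \<beta> (y t) * s < 0" using b by (simp add: distrib_left)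
  then have s: "s < 0" using b by (metis add_less_zeroD less_numeral_extra(1) mult_less_0_iff not_less_iff_gr_or_eq)
  \<comment> \<open>The coefficient for which \<open>d - a *\<^sub>R w t\<close> is orthogonal to
    \<open>y t\<close>.\<close>
  define a where "a = (d \<bullet> y t) / s"
  define e where "e = d - a *\<^sub>R w t"
  have e0: "e \<bullet> y t = 0" using s by (simp add: e_def a_def inner_diff_left s_def)
  have "d = e + a *\<^sub>R w t" by (simp add: e_def)
  then have "bil t d d = bil t (e + a *\<^sub>R w t) (e + a *\<^sub>R w t)" by simp
  also have "\<dots> = bil t e e + a\<^sup>2 * s"
    using e0 unfolding bil_quadratic bil_w[OF t] bil_commute[of t "w t" e] s_def by simp
  finally have "bil t d d + \<beta> (y t) * (d \<bullet> y t)\<^sup>2 = bil t e e + a\<^sup>2 * (s * (1 + \<beta> (y t) * s))"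
    using s by (simp add: a_def power2_eq_square field_simps)
  moreover have "s * (1 + \<beta> (y t) * s) > 0"
    using s bs by (simp add: mult_neg_neg)
  moreover have "bil t e e > 0" if "e \<noteq> 0"
    using bil_pos_of_orthogonal_to_negative[OF t _ e0 that] s by (simp add: s_def)
  moreover have "a \<noteq> 0" if "e = 0"
    using that \<open>d \<noteq> 0\<close> by (auto simp: e_def)
  moreover have "bil t e e = 0" if "e = 0" using that by (simp add: bil_def)
  ultimately show ?thesis
    by (cases "e = 0") (auto intro: add_pos_nonneg)
qed

text \<open>The minimum over the compact unit sphere is positive, and homogeneity extends the
  bound.\<close>

lemma hessian_coercive:
  assumes "dom t" "h t = 0" "h' t > 0"
  obtains m where "m > 0" "\<And>d. m * (norm d)\<^sup>2 \<le> bil t d d + \<beta> (y t) * (d \<bullet> y t)\<^sup>2"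
proof -
  define Q where "Q d = bil t d d + \<beta> (y t) * (d \<bullet> y t)\<^sup>2" for d
  have "continuous_on (sphere 0 1) Q"
    unfolding Q_def bil_def
    by (intro continuous_intros matrix_vector_mult_linear_continuous_on)
  moreover have "sphere (0::real^'n) 1 \<noteq> {}"
    using v_1_inner_self by (auto simp: norm_eq_1 intro!: exI[of _ "v 1"])
  ultimately obtain u where u: "u \<in> sphere 0 1" "\<forall>d\<in>sphere 0 1. Q u \<le> Q d"
    using continuous_attains_inf[OF compact_sphere, of 0 1 Q] by auto
  show thesis
  proof
    have "u \<noteq> 0" using u(1) by auto
    then show "Q u > 0" unfolding Q_def using hessian_pos[OF assms] by blast
    fix d :: "real^'n"
    show "Q u * (norm d)\<^sup>2 \<le> bil t d d + \<beta> (y t) * (d \<bullet> y t)\<^sup>2"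
    proof (cases "d = 0")
      case False
      then have "Q u \<le> Q (d /\<^sub>R norm d)" using u(2) by simp
      also have "\<dots> = Q d / (norm d)\<^sup>2"
        unfolding Q_def bil_simps using False by (simp add: power2_eq_square field_simps)
      finally show ?thesis using False by (simp add: Q_def field_simps)
    qed (simp add: bil_def)
  qed
qed

text \<open>As a function of the squared norm, the right-hand side has zero value, zero first
  derivative and second derivative \<open>\<beta> x / 4\<close> at \<open>x\<close>. Subtracting the
  parabola with the smaller curvature \<open>\<kappa> / 4\<close> still leaves a local
  minimum.\<close>

lemma norm_powr_taylor:
  assumes "x \<noteq> 0" and \<kappa>: "\<kappa> < \<beta> x" and tx: "t = norm x powr (p - 2)"
  shows "\<forall>\<^sub>F z in nhds x. \<kappa> / 8 * ((norm z)\<^sup>2 - (norm x)\<^sup>2)\<^sup>2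
    \<le> \<sigma> / p * (norm z powr p - norm x powr p) - \<sigma> * t / 2 * ((norm z)\<^sup>2 - (norm x)\<^sup>2)"
proof -
  define u0 where "u0 = (norm x)\<^sup>2"
  have u0: "u0 > 0" using assms by (simp add: u0_def)
  have norm_powr: "norm z powr r = ((norm z)\<^sup>2) powr (r / 2)" for z :: "real^'n" and r
    by (simp add: power2_powr)
  define f where "f u = \<sigma> / p * u powr (p / 2) - \<sigma> * t / 2 * (u - u0) - \<kappa> / 8 * (u - u0)\<^sup>2" for u
  define f' where "f' u = \<sigma> / 2 * u powr (p / 2 - 1) - \<sigma> * t / 2 - \<kappa> / 4 * (u - u0)" for u
  have t: "t = u0 powr (p / 2 - 1)"
    using norm_powr[of x "p - 2"] by (simp add: tx u0_def diff_divide_distrib)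
  have "\<forall>\<^sub>F u in nhds u0. (0::real) < u"
    using u0 eventually_nhds_in_open[of "{0<..}" u0] by simp
  then have "\<forall>\<^sub>F u in nhds u0. (f has_real_derivative f' u) (at u)"
  proof eventually_elim
    case (elim u)
    have "(f has_real_derivative \<sigma> / p * (p / 2 * u powr (p / 2 - 1)) - \<sigma> * t / 2 * 1 - \<kappa> / 8 * (2 * (u - u0))) (at u)"
      unfolding f_def using elim by (auto intro!: derivative_eq_intros)
    moreover have "\<sigma> / p * (p / 2 * u powr (p / 2 - 1)) - \<sigma> * t / 2 * 1 - \<kappa> / 8 * (2 * (u - u0)) = f' u"
      using p_gt by (simp add: f'_def)
    ultimately show ?case by simp
  qed
  moreover have "f' u0 = 0" by (simp add: f'_def t)
  moreover have "(f' has_real_derivative (\<beta> x - \<kappa>) / 4) (at u0)"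
  proof -
    have "(f' has_real_derivative \<sigma> / 2 * ((p / 2 - 1) * u0 powr (p / 2 - 1 - 1)) - \<kappa> / 4) (at u0)"
      unfolding f'_def using u0 by (auto intro!: derivative_eq_intros)
    moreover have "u0 powr (p / 2 - 1 - 1) = norm x powr (p - 4)"
      using norm_powr[of x "p - 4"] by (simp add: u0_def diff_divide_distrib)
    then have "\<sigma> / 2 * ((p / 2 - 1) * u0 powr (p / 2 - 1 - 1)) - \<kappa> / 4 = (\<beta> x - \<kappa>) / 4"
      by (simp add: \<beta>_def field_simps)
    ultimately show ?thesis by (simp only:)
  qed
  ultimately have "\<forall>\<^sub>F u in at u0. f u0 < f u"
    using second_derivative_test[of f f' u0 "(\<beta> x - \<kappa>) / 4"] \<kappa> by simp
  then have ev: "\<forall>\<^sub>F u in nhds u0. f u0 \<le> f u"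
    by (auto simp: eventually_at_filter elim!: eventually_mono)
  have "((\<lambda>z. (norm z)\<^sup>2) \<longlongrightarrow> u0) (nhds x)"
    unfolding u0_def by (intro tendsto_intros filterlim_ident)
  then have "\<forall>\<^sub>F z in nhds x. f u0 \<le> f ((norm z)\<^sup>2)"
    using ev by (rule eventually_compose_filterlim[rotated])
  then show ?thesis
  proof eventually_elim
    case (elim z)
    moreover have "f u0 = \<sigma> / p * u0 powr (p / 2)" by (simp add: f_def)
    ultimately show ?case
      unfolding f_def[of "(norm z)\<^sup>2"] norm_powr[of _ p] u0_def[symmetric]
        right_diff_distrib[of "\<sigma> / p"] by linarith
  qed
qed

lemma root_imp_local_minimizer:
  assumes t: "dom t" and root: "h t = 0" and pos: "h' t > 0"
  shows "local_minimizer g (y t)"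
proof -
  define x where "x = y t"
  have st: "stationary x t" and "x \<noteq> 0"
    using stationary_y[OF t root] by (auto simp: x_def)
  obtain m where m: "m > 0" "\<And>d. m * (norm d)\<^sup>2 \<le> bil t d d + \<beta> x * (d \<bullet> x)\<^sup>2"
    using hessian_coercive[OF assms] by (auto simp: x_def)
  have b: "\<beta> x > 0" using \<beta>_pos \<open>x \<noteq> 0\<close> .
  \<comment> \<open>Lowering the curvature from \<open>\<beta> x\<close> by \<open>\<delta>\<close>
    costs at most half of the coercivity constant \<open>m\<close>.\<close>
  define \<delta> where "\<delta> = min (\<beta> x) (m / (2 * (norm x)\<^sup>2))"
  have \<delta>: "\<delta> > 0" "\<delta> \<le> \<beta> x" "\<delta> * (norm x)\<^sup>2 \<le> m / 2"
  proof -
    show "\<delta> > 0" "\<delta> \<le> \<beta> x" using b m \<open>x \<noteq> 0\<close> by (auto simp: \<delta>_def)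
    have "\<delta> * (norm x)\<^sup>2 \<le> m / (2 * (norm x)\<^sup>2) * (norm x)\<^sup>2"
      by (intro mult_right_mono) (auto simp: \<delta>_def)
    then show "\<delta> * (norm x)\<^sup>2 \<le> m / 2" using \<open>x \<noteq> 0\<close> by simp
  qed
  define \<kappa> where "\<kappa> = \<beta> x - \<delta>"
  have \<kappa>: "\<kappa> \<ge> 0" "\<kappa> < \<beta> x" using \<delta> by (auto simp: \<kappa>_def)
  have "((\<lambda>z. \<kappa> * norm x * norm (z - x)) \<longlongrightarrow> \<kappa> * norm x * norm (x - x)) (nhds x)"
    by (intro tendsto_intros filterlim_ident)
  then have "\<forall>\<^sub>F z in nhds x. \<kappa> * norm x * norm (z - x) < m / 2"
    by (rule order_tendstoD) (use m in simp)
  moreover have "\<forall>\<^sub>F z in nhds x. \<kappa> / 8 * ((norm z)\<^sup>2 - (norm x)\<^sup>2)\<^sup>2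
    \<le> \<sigma> / p * (norm z powr p - norm x powr p) - \<sigma> * t / 2 * ((norm z)\<^sup>2 - (norm x)\<^sup>2)"
    using norm_powr_taylor[OF \<open>x \<noteq> 0\<close> \<kappa>(2)] st by (simp add: stationary_def)
  ultimately have "\<forall>\<^sub>F z in nhds x. g x \<le> g z"
  proof eventually_elim
    case (elim z)
    define d where "d = z - x"
    have z: "z = x + d" by (simp add: d_def)
    define n where "n = norm d"
    define a where "a = d \<bullet> x"
    have n: "n \<ge> 0" by (simp add: n_def)
    have an: "\<bar>a\<bar> \<le> n * norm x" unfolding a_def n_def by (rule Cauchy_Schwarz_ineq2)
    have diff: "(norm z)\<^sup>2 - (norm x)\<^sup>2 = 2 * a + n\<^sup>2"
      unfolding z a_def n_def power2_norm_eq_inner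
      by (simp add: inner_add_left inner_add_right inner_commute[of x d])
    \<comment> \<open>The quartic term is dropped and the cubic cross term is bounded by
      Cauchy-Schwarz.\<close>
    have "4 * a\<^sup>2 - 4 * (n * norm x) * n\<^sup>2 \<le> 4 * a\<^sup>2 + 4 * a * n\<^sup>2 + (n\<^sup>2)\<^sup>2"
    proof -
      have "- (n * norm x) \<le> a" using an by simp
      then have "- (n * norm x) * n\<^sup>2 \<le> a * n\<^sup>2" by (intro mult_right_mono) auto
      then have "- (4 * (n * norm x) * n\<^sup>2) \<le> 4 * a * n\<^sup>2" by simp
      moreover have "0 \<le> (n\<^sup>2)\<^sup>2" by simp
      ultimately show ?thesis by linarith
    qed
    also have "\<dots> = (2 * a + n\<^sup>2)\<^sup>2" by (simp add: power2_sum power_mult_distrib)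
    finally have "\<kappa> / 8 * (4 * a\<^sup>2 - 4 * (n * norm x) * n\<^sup>2) \<le> \<kappa> / 8 * (2 * a + n\<^sup>2)\<^sup>2"
      using \<kappa>(1) by (intro mult_left_mono) auto
    also have "\<dots> \<le> g z - g x - 1 / 2 * bil t d d"
      using elim(2) growth_identity[OF st, of d] unfolding diff z[symmetric] by simp
    finally have 1: "\<kappa> * a\<^sup>2 / 2 - (\<kappa> * norm x * n) * n\<^sup>2 / 2 \<le> g z - g x - 1 / 2 * bil t d d"
      by (simp add: algebra_simps)
    have 2: "m * n\<^sup>2 \<le> bil t d d + \<kappa> * a\<^sup>2 + \<delta> * a\<^sup>2"
      using m(2)[of d] unfolding n_def a_def \<kappa>_def by (simp add: algebra_simps)
    have "a\<^sup>2 \<le> (n * norm x)\<^sup>2" using an by (simp add: abs_le_square_iff[symmetric] n_def)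
    then have "\<delta> * a\<^sup>2 \<le> \<delta> * (norm x)\<^sup>2 * n\<^sup>2"
      using \<delta>(1) by (simp add: power_mult_distrib mult_ac)
    also have "\<dots> \<le> m / 2 * n\<^sup>2" using \<delta>(3) by (intro mult_right_mono) auto
    finally have 3: "\<delta> * a\<^sup>2 \<le> m * n\<^sup>2 / 2" by simp
    have "(\<kappa> * norm x * n) * n\<^sup>2 \<le> m / 2 * n\<^sup>2"
      using elim(1) by (intro mult_right_mono) (auto simp: n_def d_def)
    then have 4: "(\<kappa> * norm x * n) * n\<^sup>2 \<le> m * n\<^sup>2 / 2" by simp
    \<comment> \<open>By 2 and 3 the quadratic part is at least \<open>m * n\<^sup>2 / 4\<close>,
      and by 4 this absorbs the cubic term.\<close>
    show ?case using 1 2 3 4 by linarith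
  qed
  then obtain e where "e > 0" "\<And>z. dist z x < e \<Longrightarrow> g x \<le> g z"
    by (auto simp: eventually_nhds_metric)
  then show ?thesis
    unfolding local_minimizer_def x_def[symmetric] by (metis mem_ball dist_commute)
qed

lemma root_imp_local_nonglobal_minimizer:
  assumes "dom t" "h t = 0" "h' t > 0"
  shows "local_nonglobal_minimizer g (y t)"
proof -
  have "bil t (v 1) (v 1) = \<mu> t 1"
    using bil_eigenvector[OF one_in_N] v_1_inner_self by simp
  also have "\<dots> < 0" using assms by (simp add: dom_def)
  finally have "\<not> global_minimizer g (y t)"
    using global_minimizer_bil_nonneg[OF stationary_y[OF assms(1,2)]] by (metis not_less)
  then show ?thesis
    using root_imp_local_minimizer[OF assms] by (simp add: local_nonglobal_minimizer_def)
qed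

subsection \<open>Necessity\<close>

lemma bil_nonneg_of_eigenvalues:
  assumes "\<mu> t 1 \<ge> 0"
  shows "bil t d d \<ge> 0"
  unfolding bil_coords
proof (rule sum_nonneg)
  fix k assume "k \<in> N"
  then have "\<mu> t k \<ge> 0" using assms eigenvalue_le[OF one_in_N, of k] by simp
  then show "0 \<le> \<mu> t k * (d \<bullet> v k) * (d \<bullet> v k)" by (simp add: mult.assoc)
qed

text \<open>If the lowest shifted eigenvalue were nonnegative, \<open>x\<close> would be a global
  minimizer. If \<open>v 1\<close> were orthogonal to \<open>x\<close>, reflections in directions
  near \<open>v 1\<close> would contradict the negative eigenvalue.\<close>

lemma local_nonglobal_minimizer_stationary:
  assumes "local_nonglobal_minimizer g x"
  obtains t where "stationary x t" "x \<noteq> 0" "t > 0" "\<mu> t 1 < 0" "v 1 \<bullet> x \<noteq> 0"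
proof -
  have lm: "local_minimizer g x" and ng: "\<not> global_minimizer g x"
    using assms by (auto simp: local_nonglobal_minimizer_def)
  have x0: "x \<noteq> 0" using local_minimizer_zero_imp_global lm ng by auto
  define t where "t = norm x powr (p - 2)"
  have st: "stationary x t"
    unfolding t_def by (rule local_minimizer_stationary[OF lm x0])
  have neg: "\<mu> t 1 < 0"
    using stationary_psd_imp_global_minimizer[OF st x0] bil_nonneg_of_eigenvalues[of t] ng by force
  have "v 1 \<bullet> x \<noteq> 0"
  proof
    assume "v 1 \<bullet> x = 0"
    moreover have "v 1 \<noteq> 0" "x \<bullet> x \<noteq> 0" using v_1_inner_self x0 by auto
    ultimately have "bil t (v 1) (v 1) \<ge> 0"
      using eventually_quadratic_nonneg(1)[OF local_minimizer_eventually_bil_nonneg[OF st lm]] by blast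
    then show False using neg bil_eigenvector[OF one_in_N] v_1_inner_self by simp
  qed
  then show thesis using that st x0 neg by (auto simp: t_def)
qed

lemma local_minimizer_imp_dom:
  assumes st: "stationary x t" and lm: "local_minimizer g x" and "t > 0"
    and neg: "\<mu> t 1 < 0" and x1: "v 1 \<bullet> x \<noteq> 0"
  shows "dom t"
proof -
  have "\<mu> t k > 0" if k: "k \<in> N - {1}" for k
  proof (rule ccontr)
    assume le: "\<not> \<mu> t k > 0"
    \<comment> \<open>This makes \<open>d\<close> the vector in the plane of \<open>v 1\<close> and
      \<open>v k\<close> that is orthogonal to \<open>x\<close> and has coordinate 1 along
      \<open>v k\<close>. If \<open>\<mu> t k\<close> is not positive, nonnegativity of the form at
      \<open>d\<close> forces \<open>a = 0\<close>; the linear coefficient then vanishes too and the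
      quadratic one is negative.\<close>
    define a where "a = - (v k \<bullet> x) / (v 1 \<bullet> x)"
    define d where "d = v k + a *\<^sub>R v 1"
    have d1: "d \<bullet> v 1 = a" using v_inner_v_1[OF k] v_1_inner_self by (simp add: d_def inner_add_left)
    have "d \<bullet> v k = 1"
      using v_inner_v_1[OF k] v_inner_self k inner_commute[of "v 1" "v k"] by (simp add: d_def inner_add_left)
    then have "d \<noteq> 0" by auto
    moreover have "d \<bullet> x = 0"
      unfolding d_def inner_add_left inner_scaleR_left using x1 by (simp add: a_def)
    ultimately have ev: "\<forall>\<^sub>F e in at 0. 0 \<le> bil t d d + 2 * e * bil t (v 1) d + e\<^sup>2 * bil t (v 1) (v 1)"
      by (rule local_minimizer_eventually_bil_nonneg[OF st lm _ _ x1])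
    have bil1: "bil t b (v 1) = \<mu> t 1 * (b \<bullet> v 1)" for b by (rule bil_eigenvector[OF one_in_N])
    have "bil t (v k) (v k) = \<mu> t k"
      using bil_eigenvector[of k t "v k"] v_inner_self k by simp
    moreover have "bil t (v 1) (v k) = 0"
      using bil1[of "v k"] v_inner_v_1[OF k] by (simp add: bil_commute)
    ultimately have "bil t d d = \<mu> t k + a\<^sup>2 * \<mu> t 1"
      unfolding d_def bil_quadratic using bil1[of "v 1"] v_1_inner_self by simp
    moreover have "a\<^sup>2 * \<mu> t 1 \<le> 0" using neg by (simp add: mult_nonneg_nonpos)
    moreover note eventually_quadratic_nonneg(1)[OF ev]
    ultimately have "bil t d d = 0" "a\<^sup>2 * \<mu> t 1 = 0" using le by linarith+
    then have "a = 0" using neg by simp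
    then have "bil t (v 1) d = 0"
      using bil1[of d] d1 by (simp add: bil_commute)
    with \<open>bil t d d = 0\<close> have "bil t (v 1) (v 1) \<ge> 0"
      using eventually_quadratic_nonneg(3)[OF ev] by blast
    then show False using bil1[of "v 1"] v_1_inner_self neg by simp
  qed
  then show ?thesis using neg \<open>t > 0\<close> unfolding dom_def by blast
qed

text \<open>The same test, with \<open>w t\<close> corrected by a multiple of \<open>v 1\<close> to
  be orthogonal to \<open>y t\<close>: the form has the value
  \<open>- s + a\<^sup>2 * \<mu> t 1\<close> there, which rules out \<open>s > 0\<close>.\<close>

lemma local_minimizer_imp_inner_w_neg:
  assumes t: "dom t" and lm: "local_minimizer g (y t)" and root: "h t = 0"
    and x1: "v 1 \<bullet> y t \<noteq> 0"
  shows "w t \<bullet> y t < 0"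
proof (rule ccontr)
  define s where "s = w t \<bullet> y t"
  define a where "a = - s / (v 1 \<bullet> y t)"
  define d where "d = w t + a *\<^sub>R v 1"
  assume "\<not> w t \<bullet> y t < 0"
  then have s: "s \<ge> 0" by (simp add: s_def)
  have neg: "\<mu> t 1 < 0" using t by (simp add: dom_def)
  have d_x: "d \<bullet> y t = 0"
    unfolding d_def inner_add_left inner_scaleR_left using x1 by (simp add: a_def s_def)
  have d1: "\<mu> t 1 * (d \<bullet> v 1) = (v 1 \<bullet> y t) + a * \<mu> t 1"
  proof -
    have "\<mu> t 1 * (w t \<bullet> v 1) = v 1 \<bullet> y t"
      using w_coords[OF t one_in_N] neg by (simp add: inner_commute)
    then show ?thesis
      unfolding d_def inner_add_left inner_scaleR_left v_1_inner_self by (simp add: algebra_simps)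
  qed
  have "d \<noteq> 0"
  proof
    assume "d = 0"
    then have "(v 1 \<bullet> y t) + a * \<mu> t 1 = 0" using d1 by simp
    then have "(v 1 \<bullet> y t)\<^sup>2 + (v 1 \<bullet> y t) * a * \<mu> t 1 = 0"
      unfolding power2_eq_square mult.assoc distrib_left[symmetric] by simp
    moreover have "(v 1 \<bullet> y t) * a = - s" using x1 by (simp add: a_def)
    ultimately have "(v 1 \<bullet> y t)\<^sup>2 = s * \<mu> t 1" by simp
    moreover have "s * \<mu> t 1 \<le> 0" using s neg by (simp add: mult_nonneg_nonpos)
    ultimately show False using x1 by (metis not_less zero_less_power2)
  qed
  have "y t \<bullet> y t \<noteq> 0" using x1 by auto
  note ev = local_minimizer_eventually_bil_nonneg[OF stationary_y(1)[OF t root] lm \<open>d \<noteq> 0\<close> d_x this]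
  have "bil t d d = s + 2 * a * (v 1 \<bullet> y t) + a\<^sup>2 * \<mu> t 1"
    unfolding d_def bil_quadratic bil_w[OF t] s_def
    using bil_eigenvector[OF one_in_N, of t "v 1"] v_1_inner_self by simp
  also have "\<dots> = - s + a\<^sup>2 * \<mu> t 1" using x1 by (simp add: a_def)
  finally have dd: "bil t d d = - s + a\<^sup>2 * \<mu> t 1" .
  moreover have "a\<^sup>2 * \<mu> t 1 \<le> 0" using neg by (simp add: mult_nonneg_nonpos)
  ultimately have "s = 0" "bil t d d = 0"
    using eventually_quadratic_nonneg(1)[OF ev] s by linarith+
  then have "d = w t" by (simp add: d_def a_def)
  then have "bil t (y t) d = y t \<bullet> y t" by (simp add: bil_w[OF t])
  then show False
    using eventually_quadratic_nonneg(2)[OF ev \<open>bil t d d = 0\<close>] \<open>y t \<bullet> y t \<noteq> 0\<close> by simp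
qed

text \<open>The exponent 1 makes \<open>has_real_derivative_inverse_power\<close> applicable.\<close>

definition G :: "real \<Rightarrow> real" where
  "G t = - (1 / 2) * (\<Sum>k\<in>N. (\<gamma> k)\<^sup>2 / (\<mu> t k)^1) - 1 / 2 * \<sigma> * (t * \<psi> t) + \<sigma> / p * \<psi> t powr (p / 2)"

lemma g_y:
  assumes t: "dom t"
  shows "g (y t) = G t"
proof -
  have cy: "c \<bullet> y t = - (\<Sum>k\<in>N. (\<gamma> k)\<^sup>2 / (\<mu> t k)^1)"
    unfolding inner_coords[of c "y t"] sum_negf[symmetric]
    by (intro sum.cong refl) (simp only: y_coords[OF t], simp add: power2_eq_square)
  have "y t \<bullet> (H *v y t) = - (c \<bullet> y t) - \<sigma> * t * \<psi> t"
    using bil_y[OF t, of "y t"] norm_y[OF t] by (simp add: bil_def power2_norm_eq_inner)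
  moreover have "norm (y t) powr p = \<psi> t powr (p / 2)"
    using power2_powr[of "norm (y t)" "p / 2"] norm_y[OF t] by simp
  ultimately show ?thesis
    by (simp add: regularized_quadratic_def G_def cy algebra_simps)
qed

lemma G_deriv:
  assumes t: "dom t" and "\<psi> t > 0"
  shows "(G has_real_derivative \<sigma> / 2 * \<psi>' t * (\<psi> t powr (p / 2 - 1) - t)) (at t)"
proof -
  have D: "((\<lambda>s. \<Sum>k\<in>N. (\<gamma> k)\<^sup>2 / (\<mu> s k)^1) has_real_derivative - (\<sigma> * \<psi> t)) (at t)"
  proof -
    have "((\<lambda>s. \<Sum>k\<in>N. (\<gamma> k)\<^sup>2 / (\<mu> s k)^1) has_real_derivative
        (\<Sum>k\<in>N. - (real 1 * \<sigma> * (\<gamma> k)\<^sup>2 / \<mu> t k ^ Suc 1))) (at t)"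
      by (intro DERIV_sum has_real_derivative_inverse_power dom_nonzero t)
    then show ?thesis
      by (simp add: \<psi>_def sum_distrib_left sum_negf power2_eq_square mult.assoc)
  qed
  have P: "((\<lambda>s. \<psi> s powr (p / 2)) has_real_derivative p / 2 * \<psi> t powr (p / 2 - 1) * \<psi>' t) (at t)"
    using DERIV_fun_powr[OF \<psi>_deriv[OF t] assms(2), of "p / 2"] by simp
  have "(G has_real_derivative - (1 / 2) * - (\<sigma> * \<psi> t) - 1 / 2 * \<sigma> * (1 * \<psi> t + \<psi>' t * t)
      + \<sigma> / p * (p / 2 * \<psi> t powr (p / 2 - 1) * \<psi>' t)) (at t)"
    unfolding G_def
    by (intro DERIV_add DERIV_diff DERIV_cmult D P DERIV_mult DERIV_ident \<psi>_deriv[OF t])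
  moreover have "- (1 / 2) * - (\<sigma> * \<psi> t) - 1 / 2 * \<sigma> * (1 * \<psi> t + \<psi>' t * t)
      + \<sigma> / p * (p / 2 * \<psi> t powr (p / 2 - 1) * \<psi>' t) = \<sigma> / 2 * \<psi>' t * (\<psi> t powr (p / 2 - 1) - t)"
    using p_gt by (simp add: algebra_simps)
  ultimately show ?thesis by (simp only:)
qed

text \<open>The exponents \<open>p / 2 - 1\<close> and \<open>q\<close> are reciprocal, so raising
  both sides to the increasing power \<open>q\<close> gives the comparison in
  \<open>h\<close>.\<close>

lemma powr_less_iff_secular:
  assumes t: "dom t" and "\<psi> t > 0"
  shows "\<psi> t powr (p / 2 - 1) < t \<longleftrightarrow> h t < 0" and "\<psi> t powr (p / 2 - 1) > t \<longleftrightarrow> h t > 0"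
proof -
  have "t > 0" using t by (simp add: dom_def)
  have inv: "(p / 2 - 1) * q = 1" using p_gt by (simp add: q_def field_simps)
  define A where "A = \<psi> t powr (p / 2 - 1)"
  have "A > 0" using assms(2) by (simp add: A_def)
  have A: "A powr q = \<psi> t"
    unfolding A_def powr_powr inv using assms(2) by simp
  have "A < t \<Longrightarrow> A powr q < t powr q" "t < A \<Longrightarrow> t powr q < A powr q"
    using powr_less_mono2[OF q_pos] \<open>A > 0\<close> \<open>t > 0\<close> by auto
  then have "A < t \<longleftrightarrow> A powr q < t powr q" "A > t \<longleftrightarrow> A powr q > t powr q"
    by (cases A t rule: linorder_cases; force)+
  then show "\<psi> t powr (p / 2 - 1) < t \<longleftrightarrow> h t < 0" "\<psi> t powr (p / 2 - 1) > t \<longleftrightarrow> h t > 0"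
    unfolding A secular_eq[OF t] A_def[symmetric] by auto
qed

lemma tendsto_y:
  assumes t: "dom t"
  shows "(y \<longlongrightarrow> y t) (nhds t)"
proof -
  have "((\<lambda>s. \<Sum>k\<in>N. (- \<gamma> k / \<mu> s k) *\<^sub>R v k) \<longlongrightarrow> (\<Sum>k\<in>N. (- \<gamma> k / \<mu> t k) *\<^sub>R v k)) (nhds t)"
    by (intro tendsto_intros filterlim_ident dom_nonzero t)
  moreover have eq: "(\<Sum>k\<in>N. (- \<gamma> k / \<mu> s k) *\<^sub>R v k) = y s" if "dom s" for s
  proof -
    have "y s = (\<Sum>k\<in>N. (y s \<bullet> v k) *\<^sub>R v k)" by (rule expand)
    also have "\<dots> = (\<Sum>k\<in>N. (- \<gamma> k / \<mu> s k) *\<^sub>R v k)"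
      by (intro sum.cong refl) (simp only: y_coords[OF that])
    finally show ?thesis by simp
  qed
  ultimately have "((\<lambda>s. \<Sum>k\<in>N. (- \<gamma> k / \<mu> s k) *\<^sub>R v k) \<longlongrightarrow> y t) (nhds t)"
    using t by simp
  then show ?thesis
    by (rule Lim_transform_eventually) (use dom_open[OF t] eq in \<open>auto elim!: eventually_mono\<close>)
qed

text \<open>Along the curve of stationary points the objective has derivative
  \<open>\<sigma> / 2 * \<psi>' * (\<psi> powr (p / 2 - 1) - t)\<close>, whose sign is that of \<open>h\<close>. Hence \<open>h' t < 0\<close>
  makes the objective decrease to the right of \<open>t\<close>, and a double root of \<open>h\<close>, at which \<open>h\<close> is
  strictly convex, makes it decrease to the left.\<close>

lemma local_minimizer_imp_deriv_pos:
  assumes t: "dom t" and lm: "local_minimizer g (y t)" and root: "h t = 0"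
    and s: "w t \<bullet> y t < 0"
  shows "h' t > 0"
proof (rule ccontr)
  assume "\<not> h' t > 0"
  have "\<psi> t > 0" using stationary_y(2)[OF t root] norm_y[OF t] by (metis zero_less_norm_iff zero_less_power)
  \<comment> \<open>Here the sign of \<open>w t \<bullet> y t\<close> enters; near \<open>t\<close>
    it makes the derivative of \<open>G\<close> have the sign of \<open>h\<close>.\<close>
  have "\<psi>' t > 0" unfolding \<psi>'_eq[OF t] using s \<sigma>_pos by (simp add: mult_pos_neg)
  have "isCont \<psi> t" "isCont \<psi>' t"
    using \<psi>_deriv[OF t] \<psi>'_deriv[OF t] DERIV_isCont by blast+
  then have "(\<psi> \<longlongrightarrow> \<psi> t) (nhds t)" "(\<psi>' \<longlongrightarrow> \<psi>' t) (nhds t)"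
    by (simp_all add: isCont_def tendsto_at_iff_tendsto_nhds)
  then have "\<forall>\<^sub>F u in nhds t. \<psi> u > 0" "\<forall>\<^sub>F u in nhds t. \<psi>' u > 0"
    using order_tendstoD(1) \<open>\<psi> t > 0\<close> \<open>\<psi>' t > 0\<close> by blast+
  with dom_open[OF t] have near: "\<forall>\<^sub>F u in nhds t. dom u \<and> \<psi> u > 0 \<and> \<psi>' u > 0"
    by eventually_elim blast
  then have D: "\<forall>\<^sub>F u in nhds t. (G has_real_derivative \<sigma> / 2 * \<psi>' u * (\<psi> u powr (p / 2 - 1) - u)) (at u)"
    by eventually_elim (blast intro: G_deriv)
  have near_at: "\<forall>\<^sub>F u in at t within S. dom u \<and> \<psi> u > 0 \<and> \<psi>' u > 0" for S
    using near by (auto simp: eventually_at_filter elim!: eventually_mono)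
  obtain r where r: "r > 0" "\<forall>z\<in>ball (y t) r. g (y t) \<le> g z"
    using lm by (auto simp: local_minimizer_def)
  have "\<forall>\<^sub>F u in nhds t. y u \<in> ball (y t) r"
    using tendstoD[OF tendsto_y[OF t] r(1)] by (simp add: dist_commute)
  with dom_open[OF t] have "\<forall>\<^sub>F u in nhds t. G t \<le> G u"
    by eventually_elim (use r(2) g_y t in metis)
  then have min: "\<forall>\<^sub>F u in at t within S. G t \<le> G u" for S
    by (auto simp: eventually_at_filter elim!: eventually_mono)
  show False
  proof (cases "h' t = 0")
    case False
    then have "h' t < 0" using \<open>\<not> h' t > 0\<close> by simp
    from DERIV_neg_dec_right[OF secular_deriv[OF t] this]
    obtain b where b: "b > 0" "\<And>k. 0 < k \<Longrightarrow> k < b \<Longrightarrow> h (t + k) < 0" using root by metis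
    have "\<forall>\<^sub>F u in at_right t. h u < 0"
    proof (rule eventually_at_rightI[of t "t + b"])
      fix u assume "u \<in> {t<..<t + b}"
      then show "h u < 0" using b(2)[of "u - t"] by simp
    qed (use b in simp)
    with near_at have "\<forall>\<^sub>F u in at_right t. \<sigma> / 2 * \<psi>' u * (\<psi> u powr (p / 2 - 1) - u) < 0"
    proof eventually_elim
      case (elim u)
      then have "\<psi> u powr (p / 2 - 1) < u" using powr_less_iff_secular by blast
      then show ?case using elim \<sigma>_pos by (simp add: mult_pos_neg)
    qed
    from eventually_less_at_right[OF D this] min[of "{t<..}"]
    have "\<forall>\<^sub>F u in at_right t. False" by eventually_elim simp
    then show False by simp
  next
    case True
    have "\<forall>\<^sub>F u in nhds t. (h has_real_derivative h' u) (at u)"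
      using dom_open[OF t] by eventually_elim (rule secular_deriv)
    then have "\<forall>\<^sub>F u in at t. h t < h u"
      by (rule second_derivative_test[OF _ True secular_deriv2[OF t]
            secular_degenerate_root_convex[OF t root True]])
    then have "\<forall>\<^sub>F u in at_left t. h u > 0"
      by (simp add: root eventually_at_split)
    with near_at have "\<forall>\<^sub>F u in at_left t. \<sigma> / 2 * \<psi>' u * (\<psi> u powr (p / 2 - 1) - u) > 0"
    proof eventually_elim
      case (elim u)
      then have "\<psi> u powr (p / 2 - 1) > u" using powr_less_iff_secular by blast
      then show ?case using elim \<sigma>_pos by simp
    qed
    from eventually_less_at_left[OF D this] min[of "{..<t}"]
    have "\<forall>\<^sub>F u in at_left t. False" by eventually_elim simp
    then show False by simp
  qed
qed

theorem local_nonglobal_minimizer_iff: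
  "local_nonglobal_minimizer g x \<longleftrightarrow> (\<exists>t. dom t \<and> h t = 0 \<and> h' t > 0 \<and> x = y t)"
proof
  assume lng: "local_nonglobal_minimizer g x"
  then have lm: "local_minimizer g x" by (simp add: local_nonglobal_minimizer_def)
  obtain t where st: "stationary x t" and t: "t > 0" "\<mu> t 1 < 0" and x1: "v 1 \<bullet> x \<noteq> 0"
    using local_nonglobal_minimizer_stationary[OF lng] .
  have dom: "dom t" by (rule local_minimizer_imp_dom[OF st lm t x1])
  note x = stationary_imp_root[OF st dom]
  have "w t \<bullet> y t < 0"
    using local_minimizer_imp_inner_w_neg[OF dom _ x(2)] lm x1 x(1) by simp
  then have "h' t > 0"
    using local_minimizer_imp_deriv_pos[OF dom _ x(2)] lm x(1) by simp
  then show "\<exists>t. dom t \<and> h t = 0 \<and> h' t > 0 \<and> x = y t"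
    using dom x by blast
qed (use root_imp_local_nonglobal_minimizer in blast)

end

theorem theorem3:
  fixes H :: "real^'n^'n" and c x :: "real^'n" and \<sigma> p :: real and \<alpha> :: "nat \<Rightarrow> real"
  assumes "transpose H = H"
    and "ordered_eigenvalues H \<alpha>"
    and "\<sigma> > 0"
    and "p > 2"
  shows "local_nonglobal_minimizer (regularized_quadratic H c \<sigma> p) x \<longleftrightarrow>
    (\<exists>t \<in> secular_domain CARD('n) \<alpha> \<sigma>.
       secular_function H c \<sigma> p t = 0 \<and>
       deriv (secular_function H c \<sigma> p) t > 0 \<and>
       x = - (shifted_inverse H \<sigma> t *v c))"
proof -
  obtain v where v:
    "\<And>i j. i \<in> {1..CARD('n)} \<Longrightarrow> j \<in> {1..CARD('n)} \<Longrightarrow> v i \<bullet> v j = (if i = j then 1 else 0)"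
    "\<And>i. i \<in> {1..CARD('n)} \<Longrightarrow> H *v v i = \<alpha> i *\<^sub>R v i"
    "\<And>y. y = (\<Sum>i=1..CARD('n). (y \<bullet> v i) *\<^sub>R v i)"
    by (rule ordered_eigenvalues_eigenbasis[OF assms(1,2)]) blast
  interpret diagonalized_problem H c \<sigma> p "CARD('n)" \<alpha> v
  proof
    show "mono_on {1..CARD('n)} \<alpha>" using assms(2) by (simp add: ordered_eigenvalues_def)
  qed (use assms v in blast)+
  show ?thesis
    unfolding local_nonglobal_minimizer_iff Bex_def secular_domain_iff y_def[symmetric]
    using deriv_secular by metis
qed

end
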